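(* Suppose the Optimality Condition, the Cost Regularity Condition and the Correct Side Information Condition (all stated in the context) hold, and that the Hessian estimator satisfies $\|\hat I_\ell(\hat\theta_{EO})-I_\ell(\theta^* )\|_2=o_p(1)$. Let $\widehat H$ be the output of the analytical procedure: $$\widehat H=-\mathbb{E}_{\hat{\mathbb{P}}_n}[\widehat{\mathrm{IF}}(\xi)\widehat M(\hat\theta_{EO};\xi)^\top]\Big(\mathbb{E}_{\hat{\mathbb{P}}_n}[\widehat M(\hat\theta_{EO};\xi)\widehat M(\hat\theta_{EO};\xi)^\top]\Big)^{\dagger},$$ where $\widehat{\mathrm{IF}}(\xi):=-\hat I_\ell(\hat\theta_{EO})^\dagger\nabla_\theta\ell(\hat\theta_{EO};\xi)$ and $\widehat M(\theta;\xi)=M(\theta;\xi)+\big(\frac1n\sum_{i=1}^n\nabla_\theta M(\theta;\xi_i)\big)\widehat{\mathrm{IF}}(\xi)$. Then $\|\widehat H-H^*\|=o_p(1)$, where $$H^*:=-\mathbb{E}_{\mathbb{P}}[\mathrm{IF}(\xi)\widetilde M(\theta^*;\xi)^\top]\big(\mathbb{E}_{\mathbb{P}}[\widetilde M(\theta^*;\xi)\widetilde M(\theta^*;\xi)^\top]\big)^{\dagger}.$$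
   Context: Setting: $\xi\in\Xi$ is random with distribution $\mathbb{P}$, $\Theta\subseteq\mathbb{R}^{D_\theta}$, $\ell:\Theta\times\Xi\to\mathbb{R}$ is a known cost function, $Z(\theta):=\mathbb{E}_{\mathbb{P}}[\ell(\theta;\xi)]$, $\theta^*\in\arg\min_{\theta\in\Theta}Z(\theta)$. Data $\{\xi_i\}_{i=1}^n$ are i.i.d. from $\mathbb{P}$ with empirical distribution $\hat{\mathbb{P}}_n$; $\hat\theta_{EO}$ is the empirical optimization (EO) solution, minimizing $\mathbb{E}_{\hat{\mathbb{P}}_n}[\ell(\theta;\xi)]$ over $\Theta$ (up to the tolerance below). $\|\cdot\|$ is the operator norm, $\dagger$ the Moore–Penrose pseudoinverse. The Hessian estimator: if $\ell$ is twice differentiable in $\theta$, $\hat I_\ell(\hat\theta_{EO})=\frac1n\sum_{i=1}^n\nabla_\theta^2\ell(\hat\theta_{EO};\xi_i)$; otherwise $\hat I_\ell(\hat\theta_{EO})$ is a problem-specific consistent estimator of $I_\ell(\theta^* )$. Optimality Condition: the minimizer $\theta^*$ of $Z$ is unique, lies in the interior of $\Theta$ (or $\Theta=\mathbb{R}^{D_\theta}$), $\nabla_\theta Z(\theta^* )=0$, and $I_\ell(\theta^* ):=\nabla_\theta^2Z(\theta^* )$ is positive definite. Cost Regularity Condition: $\ell(\theta;\xi)$ is differentiable at $\theta^*$ for almost every $\xi$; for all $\theta_1,\theta_2\in\Theta$, $|\ell(\theta_1;\xi)-\ell(\theta_2;\xi)|\le L(\xi)\|\theta_1-\theta_2\|$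 with $\mathbb{E}_{\mathbb{P}}[L^3(\xi)]<\infty$; and $\mathbb{E}_{\hat{\mathbb{P}}_n}[\ell(\hat\theta_{EO};\xi)]\le\min_{\theta\in\Theta}\mathbb{E}_{\hat{\mathbb{P}}_n}[\ell(\theta;\xi)]+o_p(n^{-1})$. ($\nabla_\theta$ denotes gradient or subgradient.) Notation: $\mathrm{IF}(\xi):=-(\nabla_\theta^2Z(\theta^* ))^{-1}\nabla_\theta\ell(\theta^*;\xi)$, $\Sigma_0:=\mathbb{E}_{\mathbb{P}}[\mathrm{IF}(\xi)\mathrm{IF}(\xi)^\top]$, $\mu_M(\theta):=\mathbb{E}_{\mathbb{P}}[M(\theta;\xi)]$, $\Gamma:=\mathrm{Cov}_{\mathbb{P}}[\mathrm{IF}(\xi),M(\theta^*;\xi)]$, $\widetilde M(\theta;\xi):=M(\theta;\xi)+\nabla_\theta\mu_M(\theta)\mathrm{IF}(\xi)$. Correct Side Information Condition on the given $M:\Theta\times\Xi\to\mathbb{R}^{D_M}$: $\mu_M(\theta^* )=\mathbf{0}$; $\Sigma_0\nabla_\theta\mu_M(\theta^* )^\top+\Gamma\neq\mathbf{0}$; $\mathrm{Var}_{\mathbb{P}}[\widetilde M(\theta^*;\xi)]\succ0$; and there is a neighborhood $\mathcal{N}$ of $\theta^*$ such that $\theta\mapsto M(\theta;\xi)$ is continuously differentiable on $\mathcal{N}$ and $\mathbb{E}_{\mathbb{P}}[\sup_{\theta\in\mathcal{N}}\max\{\|M(\theta;\xi)\|_2^3,\|\nabla_\theta M(\theta;\x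i)\|^3\}]<\infty$.
   Formalization: Two assumptions are added, without which the claim fails: the EO solution stays in a compact subset of Θ with probability near 1 (automatic for compact Θ), and ℓ(·;ξ) is strictly differentiable at θ* for almost every ξ (automatic for convex or C¹ costs). *)

theory Defs
  imports "HOL-Probability.Probability"
begin

section \<open>Differential calculus\<close>

definition grad :: "('a::real_inner \<Rightarrow> real) \<Rightarrow> 'a \<Rightarrow> 'a" where
  "grad f x = (THE g. GDERIV f x :> g)"

definition hessian :: "(real^'d \<Rightarrow> real) \<Rightarrow> real^'d \<Rightarrow> real^'d^'d" where
  "hessian f x = jacobian (grad f) (at x)"

definition twice_differentiable_at :: "(real^'d \<Rightarrow> real) \<Rightarrow> real^'d \<Rightarrow> bool" where
  "twice_differentiable_at f x \<longleftrightarrow>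
     (\<forall>\<^sub>F y in nhds x. f differentiable (at y)) \<and> grad f differentiable (at x)"

text \<open>The Clarke subdifferential: the Limsup is the generalised directional derivative in
  direction \<open>v\<close>. For a convex \<open>f\<close> on a neighbourhood of \<open>x\<close> it is the convex subdifferential,
  for a continuously differentiable \<open>f\<close> it is the singleton of the gradient, and for a locally
  Lipschitz \<open>f\<close> it contains the gradient wherever that exists.\<close>

definition clarke_subdifferential :: "('a::real_inner \<Rightarrow> real) \<Rightarrow> 'a \<Rightarrow> 'a set" where
  "clarke_subdifferential f x =
     {g. \<forall>v. ereal (g \<bullet> v) \<le>
        Limsup (nhds x \<times>\<^sub>F at_right 0) (\<lambda>(y, t). ereal ((f (y + t *\<^sub>R v) - f y) / t))}"

definition strictly_differentiable_at :: "('a::real_normed_vector \<Rightarrow> real) \<Rightarrow> 'a \<Rightarrow> bool" where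
  "strictly_differentiable_at f x \<longleftrightarrow>
     (\<exists>D. bounded_linear D \<and>
        ((\<lambda>(y, z). (f y - f z - D (y - z)) / norm (y - z)) \<longlongrightarrow> 0) (nhds x \<times>\<^sub>F nhds x))"


section \<open>Matrices\<close>

definition op_norm :: "real^'n^'m \<Rightarrow> real" where
  "op_norm A = onorm (\<lambda>v. A *v v)"

definition pos_def :: "real^'n^'n \<Rightarrow> bool" where
  "pos_def A \<longleftrightarrow> transpose A = A \<and> (\<forall>v. v \<noteq> 0 \<longrightarrow> 0 < v \<bullet> (A *v v))"

text \<open>The matrix \<open>x y\<^sup>T\<close>.\<close>

definition outer :: "real^'m \<Rightarrow> real^'n \<Rightarrow> real^'n^'m" where
  "outer x y = (\<chi> i j. x $ i * y $ j)"

text \<open>Moore--Penrose pseudoinverse, by the four Penrose equations.\<close>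

definition pinv :: "real^'n^'m \<Rightarrow> real^'m^'n" where
  "pinv A = (THE B. A ** B ** A = A \<and> B ** A ** B = B \<and>
                    transpose (A ** B) = A ** B \<and> transpose (B ** A) = B ** A)"


section \<open>Probability\<close>

text \<open>Outer probability is the ordinary probability on measurable events; it is used because
  measurability of the estimators is not assumed, and \<^const>\<open>measure\<close> would be 0 on a
  non-measurable event.\<close>

definition small_op :: "'w measure \<Rightarrow> (nat \<Rightarrow> 'w \<Rightarrow> real) \<Rightarrow> bool" where
  "small_op S X \<longleftrightarrow>
     (\<forall>\<epsilon>>0. (\<lambda>n. outer_measure_of S {\<omega> \<in> space S. \<epsilon> < \<bar>X n \<omega>\<bar>}) \<longlonglongrightarrow> 0)"

definition tight_in :: "'w measure \<Rightarrow> 'a::topological_space set \<Rightarrow> (nat \<Rightarrow> 'w \<Rightarrow> 'a) \<Rightarrow> bool" where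
  "tight_in S \<Theta> X \<longleftrightarrow>
     (\<forall>\<eta>>0. \<exists>K. compact K \<and> K \<subseteq> \<Theta> \<and>
        (\<forall>\<^sub>F n in sequentially. outer_measure_of S {\<omega> \<in> space S. X n \<omega> \<notin> K} \<le> ennreal \<eta>))"

definition iid_sample :: "'w measure \<Rightarrow> 'x measure \<Rightarrow> (nat \<Rightarrow> 'w \<Rightarrow> 'x) \<Rightarrow> bool" where
  "iid_sample S P \<xi> \<longleftrightarrow>
     prob_space S \<and> prob_space.indep_vars S (\<lambda>_. P) \<xi> UNIV \<and> (\<forall>i. distr S P (\<xi> i) = P)"

definition emp :: "(nat \<Rightarrow> 'w \<Rightarrow> 'x) \<Rightarrow> nat \<Rightarrow> 'w \<Rightarrow> ('x \<Rightarrow> 'b::real_vector) \<Rightarrow> 'b" where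
  "emp \<xi> n \<omega> f = (1 / real n) *\<^sub>R (\<Sum>i<n. f (\<xi> i \<omega>))"

definition covar :: "'x measure \<Rightarrow> ('x \<Rightarrow> real^'m) \<Rightarrow> ('x \<Rightarrow> real^'n) \<Rightarrow> real^'n^'m" where
  "covar P X Y = (\<integral>x. outer (X x - (\<integral>x. X x \<partial>P)) (Y x - (\<integral>x. Y x \<partial>P)) \<partial>P)"


section \<open>Population quantities\<close>

text \<open>Throughout, \<open>dl \<theta> x\<close> is the chosen (sub)gradient of \<open>\<lambda>\<theta>. l \<theta> x\<close> at \<open>\<theta>\<close>.\<close>

definition risk :: "'x measure \<Rightarrow> ('t \<Rightarrow> 'x \<Rightarrow> real) \<Rightarrow> 't \<Rightarrow> real" where
  "risk P l \<theta> = (\<integral>x. l \<theta> x \<partial>P)"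

definition mu :: "'x measure \<Rightarrow> ('t \<Rightarrow> 'x \<Rightarrow> real^'m) \<Rightarrow> 't \<Rightarrow> real^'m" where
  "mu P M \<theta> = (\<integral>x. M \<theta> x \<partial>P)"

definition IF :: "'x measure \<Rightarrow> (real^'d \<Rightarrow> 'x \<Rightarrow> real) \<Rightarrow> (real^'d \<Rightarrow> 'x \<Rightarrow> real^'d)
    \<Rightarrow> real^'d \<Rightarrow> 'x \<Rightarrow> real^'d" where
  "IF P l dl \<theta>s x = - (matrix_inv (hessian (risk P l) \<theta>s) *v dl \<theta>s x)"

definition Sigma0 :: "'x measure \<Rightarrow> (real^'d \<Rightarrow> 'x \<Rightarrow> real) \<Rightarrow> (real^'d \<Rightarrow> 'x \<Rightarrow> real^'d)
    \<Rightarrow> real^'d \<Rightarrow> real^'d^'d" where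
  "Sigma0 P l dl \<theta>s = (\<integral>x. outer (IF P l dl \<theta>s x) (IF P l dl \<theta>s x) \<partial>P)"

definition Gamma0 :: "'x measure \<Rightarrow> (real^'d \<Rightarrow> 'x \<Rightarrow> real) \<Rightarrow> (real^'d \<Rightarrow> 'x \<Rightarrow> real^'d)
    \<Rightarrow> (real^'d \<Rightarrow> 'x \<Rightarrow> real^'m) \<Rightarrow> real^'d \<Rightarrow> real^'m^'d" where
  "Gamma0 P l dl M \<theta>s = covar P (IF P l dl \<theta>s) (M \<theta>s)"

definition Mtilde :: "'x measure \<Rightarrow> (real^'d \<Rightarrow> 'x \<Rightarrow> real) \<Rightarrow> (real^'d \<Rightarrow> 'x \<Rightarrow> real^'d)
    \<Rightarrow> (real^'d \<Rightarrow> 'x \<Rightarrow> real^'m) \<Rightarrow> real^'d \<Rightarrow> real^'d \<Rightarrow> 'x \<Rightarrow> real^'m" where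
  "Mtilde P l dl M \<theta>s \<theta> x = M \<theta> x + jacobian (mu P M) (at \<theta>) *v IF P l dl \<theta>s x"

definition Hstar :: "'x measure \<Rightarrow> (real^'d \<Rightarrow> 'x \<Rightarrow> real) \<Rightarrow> (real^'d \<Rightarrow> 'x \<Rightarrow> real^'d)
    \<Rightarrow> (real^'d \<Rightarrow> 'x \<Rightarrow> real^'m) \<Rightarrow> real^'d \<Rightarrow> real^'m^'d" where
  "Hstar P l dl M \<theta>s =
     - ((\<integral>x. outer (IF P l dl \<theta>s x) (Mtilde P l dl M \<theta>s \<theta>s x) \<partial>P) **
        pinv (\<integral>x. outer (Mtilde P l dl M \<theta>s \<theta>s x) (Mtilde P l dl M \<theta>s \<theta>s x) \<partial>P))"


section \<open>Estimators\<close>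

text \<open>Here \<open>I\<close> and \<open>t\<close> are the realised values of the Hessian estimator and of the EO
  solution.\<close>

definition IF_hat :: "(real^'d \<Rightarrow> 'x \<Rightarrow> real^'d) \<Rightarrow> real^'d^'d \<Rightarrow> real^'d \<Rightarrow> 'x \<Rightarrow> real^'d" where
  "IF_hat dl I t x = - (pinv I *v dl t x)"

definition M_hat :: "(real^'d \<Rightarrow> 'x \<Rightarrow> real^'d) \<Rightarrow> (real^'d \<Rightarrow> 'x \<Rightarrow> real^'m)
    \<Rightarrow> (nat \<Rightarrow> 'w \<Rightarrow> 'x) \<Rightarrow> nat \<Rightarrow> 'w \<Rightarrow> real^'d^'d \<Rightarrow> real^'d \<Rightarrow> real^'d \<Rightarrow> 'x \<Rightarrow> real^'m" where
  "M_hat dl M \<xi> n \<omega> I t \<theta> x =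
     M \<theta> x + emp \<xi> n \<omega> (\<lambda>x'. jacobian (\<lambda>\<theta>. M \<theta> x') (at \<theta>)) *v IF_hat dl I t x"

definition H_hat :: "(real^'d \<Rightarrow> 'x \<Rightarrow> real^'d) \<Rightarrow> (real^'d \<Rightarrow> 'x \<Rightarrow> real^'m)
    \<Rightarrow> (nat \<Rightarrow> 'w \<Rightarrow> 'x) \<Rightarrow> nat \<Rightarrow> 'w \<Rightarrow> real^'d^'d \<Rightarrow> real^'d \<Rightarrow> real^'m^'d" where
  "H_hat dl M \<xi> n \<omega> I t =
     - (emp \<xi> n \<omega> (\<lambda>x. outer (IF_hat dl I t x) (M_hat dl M \<xi> n \<omega> I t t x)) **
        pinv (emp \<xi> n \<omega> (\<lambda>x. outer (M_hat dl M \<xi> n \<omega> I t t x) (M_hat dl M \<xi> n \<omega> I t t x))))"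

text \<open>If the cost is twice differentiable, the Hessian estimator is the empirical Hessian at the
  EO solution; otherwise its form is left open. On the boundary of \<open>\<Theta>\<close>, where the derivatives
  would depend on values of \<open>l\<close> outside \<open>\<Theta>\<close>, nothing is prescribed.\<close>

definition hessian_estimator :: "'x measure \<Rightarrow> 'w measure \<Rightarrow> (real^'d) set \<Rightarrow> (real^'d \<Rightarrow> 'x \<Rightarrow> real)
    \<Rightarrow> (nat \<Rightarrow> 'w \<Rightarrow> 'x) \<Rightarrow> (nat \<Rightarrow> 'w \<Rightarrow> real^'d) \<Rightarrow> (nat \<Rightarrow> 'w \<Rightarrow> real^'d^'d) \<Rightarrow> bool" where
  "hessian_estimator P S \<Theta> l \<xi> \<theta>h Ih \<longleftrightarrow>
     ((\<forall>x\<in>space P. \<forall>\<theta>\<in>interior \<Theta>. twice_differentiable_at (\<lambda>\<theta>. l \<theta> x) \<theta>) \<longrightarrow>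
      (\<forall>n. \<forall>\<omega>\<in>space S. \<theta>h n \<omega> \<in> interior \<Theta> \<longrightarrow>
         Ih n \<omega> = emp \<xi> n \<omega> (\<lambda>x. hessian (\<lambda>\<theta>. l \<theta> x) (\<theta>h n \<omega>))))"


section \<open>Conditions\<close>

definition optimality_condition :: "'x measure \<Rightarrow> (real^'d) set \<Rightarrow> (real^'d \<Rightarrow> 'x \<Rightarrow> real)
    \<Rightarrow> real^'d \<Rightarrow> bool" where
  "optimality_condition P \<Theta> l \<theta>s \<longleftrightarrow>
     (\<forall>\<theta>\<in>\<Theta>. integrable P (l \<theta>)) \<and>
     \<theta>s \<in> \<Theta> \<and> (\<forall>\<theta>\<in>\<Theta>. \<theta> \<noteq> \<theta>s \<longrightarrow> risk P l \<theta>s < risk P l \<theta>) \<and>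
     (\<theta>s \<in> interior \<Theta> \<or> \<Theta> = UNIV) \<and>
     twice_differentiable_at (risk P l) \<theta>s \<and>
     grad (risk P l) \<theta>s = 0 \<and>
     pos_def (hessian (risk P l) \<theta>s)"

text \<open>The last conjunct says that the excess empirical risk \<open>r n\<close> is of order \<open>o_p(1/n)\<close>.\<close>

definition cost_regularity_condition :: "'x measure \<Rightarrow> 'w measure \<Rightarrow> (real^'d) set
    \<Rightarrow> (real^'d \<Rightarrow> 'x \<Rightarrow> real) \<Rightarrow> (real^'d \<Rightarrow> 'x \<Rightarrow> real^'d) \<Rightarrow> real^'d
    \<Rightarrow> (nat \<Rightarrow> 'w \<Rightarrow> 'x) \<Rightarrow> (nat \<Rightarrow> 'w \<Rightarrow> real^'d) \<Rightarrow> bool" where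
  "cost_regularity_condition P S \<Theta> l dl \<theta>s \<xi> \<theta>h \<longleftrightarrow>
     (AE x in P. (\<lambda>\<theta>. l \<theta> x) differentiable (at \<theta>s)) \<and>
     (\<exists>L\<in>borel_measurable P. integrable P (\<lambda>x. L x ^ 3) \<and>
        (AE x in P. \<forall>\<theta>1\<in>\<Theta>. \<forall>\<theta>2\<in>\<Theta>. \<bar>l \<theta>1 x - l \<theta>2 x\<bar> \<le> L x * norm (\<theta>1 - \<theta>2))) \<and>
     (\<forall>\<theta>\<in>\<Theta>. dl \<theta> \<in> borel_measurable P) \<and>
     (AE x in P. \<forall>\<theta>\<in>interior \<Theta>. dl \<theta> x \<in> clarke_subdifferential (\<lambda>\<theta>. l \<theta> x) \<theta>) \<and>
     (\<forall>n. \<forall>\<omega>\<in>space S. \<theta>h n \<omega> \<in> \<Theta>) \<and>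
     (\<exists>r. small_op S (\<lambda>n \<omega>. real n * r n \<omega>) \<and>
        (\<forall>n\<ge>1. AE \<omega> in S. \<forall>\<theta>\<in>\<Theta>. emp \<xi> n \<omega> (l (\<theta>h n \<omega>)) \<le> emp \<xi> n \<omega> (l \<theta>) + r n \<omega>))"

definition correct_side_information :: "'x measure \<Rightarrow> (real^'d) set \<Rightarrow> (real^'d \<Rightarrow> 'x \<Rightarrow> real)
    \<Rightarrow> (real^'d \<Rightarrow> 'x \<Rightarrow> real^'d) \<Rightarrow> (real^'d \<Rightarrow> 'x \<Rightarrow> real^'m) \<Rightarrow> real^'d \<Rightarrow> bool" where
  "correct_side_information P \<Theta> l dl M \<theta>s \<longleftrightarrow>
     (\<forall>\<theta>\<in>\<Theta>. M \<theta> \<in> borel_measurable P) \<and>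
     mu P M \<theta>s = 0 \<and>
     Sigma0 P l dl \<theta>s ** transpose (jacobian (mu P M) (at \<theta>s)) + Gamma0 P l dl M \<theta>s \<noteq> 0 \<and>
     pos_def (covar P (Mtilde P l dl M \<theta>s \<theta>s) (Mtilde P l dl M \<theta>s \<theta>s)) \<and>
     (\<exists>N. open N \<and> \<theta>s \<in> N \<and> N \<subseteq> \<Theta> \<and>
        (\<forall>x\<in>space P. (\<forall>\<theta>\<in>N. (\<lambda>\<theta>. M \<theta> x) differentiable (at \<theta>)) \<and>
           continuous_on N (\<lambda>\<theta>. jacobian (\<lambda>\<theta>. M \<theta> x) (at \<theta>))) \<and>
        (\<integral>\<^sup>+x. (SUP \<theta>\<in>N. ennreal (max (norm (M \<theta> x) ^ 3)
           (op_norm (jacobian (\<lambda>\<theta>. M \<theta> x) (at \<theta>)) ^ 3))) \<partial>P) < \<infinity>)"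


section \<open>Two regularity assumptions implicit in the conditions above\<close>

text \<open>
  \<^item> Consistency of the EO solution must be derivable. On a non-compact \<open>\<Theta>\<close>, uniqueness of the
    minimiser does not prevent the EO solution from escaping: with \<open>\<Theta> = \<real>\<close>, \<open>Z \<theta> = \<theta>\<^sup>2 / (1 + \<theta>^4)\<close>
    and \<open>l \<theta> x = Z \<theta> + x * max (-1) (min 1 \<theta>)\<close> for a centred \<open>x\<close>, the empirical infimum is
    approached only at infinity, with probability tending to 1. Tightness of the EO solution in \<open>\<Theta>\<close>
    (\<^const>\<open>tight_in\<close>), automatic for compact \<open>\<Theta>\<close>, excludes this; consistency then follows from
    the other conditions.
  \<^item> Differentiability at \<open>\<theta>s\<close> alone does not relate the (sub)gradient near \<open>\<theta>s\<close> to the one at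
    \<open>\<theta>s\<close>: take \<open>l \<theta> (x, s) = \<theta>\<^sup>2 / 2 - x * \<theta> + c * s * \<theta>\<^sup>2 * sin (1 / \<theta>)\<close> on \<open>\<Theta> = {-1..1}\<close> with an
    independent random sign \<open>s\<close>, and \<open>M \<theta> (x, s) = x + s\<close>. Here the sample mean of \<open>x\<close> is an
    admissible EO solution, and the gradient at it oscillates. Differentiability is therefore
    understood as strict differentiability. For a cost that is convex, or continuously
    differentiable, near \<open>\<theta>s\<close>, this is the same as differentiability.\<close>

definition ae_strictly_differentiable :: "'x measure \<Rightarrow> (real^'d \<Rightarrow> 'x \<Rightarrow> real) \<Rightarrow> real^'d \<Rightarrow> bool" where
  "ae_strictly_differentiable P l \<theta>s \<longleftrightarrow>
     (AE x in P. strictly_differentiable_at (\<lambda>\<theta>. l \<theta> x) \<theta>s)"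

end

theory Submission
  imports Defs
begin

text \<open>
  On a small ball around the target parameter every integrand in the estimator is dominated by an
  integrable envelope, and its oscillation is bounded by measurable moduli that tend to 0 almost
  everywhere; for the subgradients this is where strict differentiability enters. A plug-in
  empirical mean at a consistent estimator then differs from the one at the target by at most an
  empirical mean of small expectation, so the weak law suffices. Treating the inverse Hessian and
  the Jacobian as further parameters of the integrand makes both factors of the estimator such
  plug-in means, and the pseudoinverse is continuous at the limit because the covariance is
  positive definite.
\<close>

section \<open>Convergence in outer probability\<close>

text \<open>The main obstacle is the subgradient. \<open>dl\<close> is an arbitrary selection from
  the Clarke subdifferential, so \<open>dl \<theta> x\<close> may jump at points other than
  \<open>\<theta>s\<close>, and its oscillation over a ball is a supremum over uncountably many
  functions with no continuity to exploit. The way out is to read the oscillation off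
  \<open>l\<close> itself: if all increments of \<open>l\<close> on a ball are those of the linear
  map given by \<open>dl \<theta>s x\<close> up to a relative error c, then every subgradient taken
  in that ball lies within c of \<open>dl \<theta>s x\<close>. The least such c is a supremum of
  difference quotients, which are continuous in the pair of points; hence it is measurable through a
  countable dense set, and strict differentiability sends it to 0 as the ball shrinks. Moments are
  tracked by an exponent. Both factors average products of two families, so the influence function
  and the side information carry exponent 2; the Jacobian enters through its own mean and carries
  exponent 1. The Lipschitz bound on \<open>l\<close> is used a second time, away from
  \<open>\<theta>s\<close>, to show consistency of the EO solution.\<close>

definition whp :: "'w measure \<Rightarrow> (nat \<Rightarrow> 'w \<Rightarrow> bool) \<Rightarrow> bool" where
  "whp S Q \<longleftrightarrow> (\<forall>\<eta>>0. \<forall>\<^sub>F n in sequentially.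
     \<exists>A\<in>sets S. emeasure S A \<le> ennreal \<eta> \<and> (\<forall>\<omega>\<in>space S - A. Q n \<omega>))"

lemma whpD:
  assumes "whp S Q" "0 < \<eta>"
  shows "\<forall>\<^sub>F n in sequentially.
    \<exists>A\<in>sets S. emeasure S A \<le> ennreal \<eta> \<and> (\<forall>\<omega>\<in>space S - A. Q n \<omega>)"
  using assms unfolding whp_def by blast

lemma whp_mono_eventually:
  assumes "whp S Q" and "\<forall>\<^sub>F n in sequentially. \<forall>\<omega>\<in>space S. Q n \<omega> \<longrightarrow> R n \<omega>"
  shows "whp S R"
  unfolding whp_def
proof (intro allI impI)
  fix \<eta> :: real assume "0 < \<eta>"
  from whpD[OF assms(1) this] assms(2)
  show "\<forall>\<^sub>F n in sequentially.
    \<exists>A\<in>sets S. emeasure S A \<le> ennreal \<eta> \<and> (\<forall>\<omega>\<in>space S - A. R n \<omega>)"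
    by eventually_elim fast
qed

lemma whp_mono:
  assumes "whp S Q" and "\<And>n \<omega>. \<omega> \<in> space S \<Longrightarrow> Q n \<omega> \<Longrightarrow> R n \<omega>"
  shows "whp S R"
  by (rule whp_mono_eventually[OF assms(1)]) (use assms(2) in auto)

lemma whp_conj:
  assumes "whp S Q" "whp S R"
  shows "whp S (\<lambda>n \<omega>. Q n \<omega> \<and> R n \<omega>)"
  unfolding whp_def
proof (intro allI impI)
  fix \<eta> :: real assume "0 < \<eta>"
  then have h: "0 < \<eta> / 2" by simp
  from whpD[OF assms(1) h] whpD[OF assms(2) h]
  show "\<forall>\<^sub>F n in sequentially.
    \<exists>A\<in>sets S. emeasure S A \<le> ennreal \<eta> \<and> (\<forall>\<omega>\<in>space S - A. Q n \<omega> \<and> R n \<omega>)"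
  proof eventually_elim
    case (elim n)
    then obtain A B where A: "A \<in> sets S" "emeasure S A \<le> ennreal (\<eta>/2)" "\<forall>\<omega>\<in>space S - A. Q n \<omega>"
      and B: "B \<in> sets S" "emeasure S B \<le> ennreal (\<eta>/2)" "\<forall>\<omega>\<in>space S - B. R n \<omega>"
      by blast
    have "emeasure S (A \<union> B) \<le> emeasure S A + emeasure S B"
      using A B by (intro emeasure_subadditive)
    also have "\<dots> \<le> ennreal (\<eta>/2) + ennreal (\<eta>/2)"
      using A B by (intro add_mono)
    also have "\<dots> = ennreal \<eta>"
      using \<open>0 < \<eta>\<close> by (simp flip: ennreal_plus)
    finally show ?case
      using A B by (intro bexI[of _ "A \<union> B"]) auto
  qed
qed

lemma whp_AE:
  assumes "\<forall>\<^sub>F n in sequentially. AE \<omega> in S. Q n \<omega>"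
  shows "whp S Q"
  unfolding whp_def
proof (intro allI impI)
  fix \<eta> :: real
  show "\<forall>\<^sub>F n in sequentially.
    \<exists>A\<in>sets S. emeasure S A \<le> ennreal \<eta> \<and> (\<forall>\<omega>\<in>space S - A. Q n \<omega>)"
    using assms
  proof eventually_elim
    case (elim n)
    then obtain N where "{\<omega>\<in>space S. \<not> Q n \<omega>} \<subseteq> N" "emeasure S N = 0" "N \<in> sets S"
      by (rule AE_E)
    then show ?case by (intro bexI[of _ N]) auto
  qed
qed

lemma whp_ball_finite:
  assumes "finite T" "\<And>t. t \<in> T \<Longrightarrow> whp S (Q t)"
  shows "whp S (\<lambda>n \<omega>. \<forall>t\<in>T. Q t n \<omega>)"
  using assms
proof (induction T rule: finite_induct)
  case empty
  then show ?case by (intro whp_AE) auto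
next
  case (insert t T)
  have "whp S (\<lambda>n \<omega>. Q t n \<omega> \<and> (\<forall>t\<in>T. Q t n \<omega>))"
    using insert by (intro whp_conj) auto
  then show ?case by simp
qed

text \<open>Outer measure is the least measure of a measurable cover, and this minimum is attained;
  the cover is the exceptional set in \<open>whp\<close>. With \<open>whp\<close>, union bounds are
  taken over measurable sets while the predicates themselves stay arbitrary.\<close>

lemma small_op_iff_whp:
  "small_op S X \<longleftrightarrow> (\<forall>\<epsilon>>0. whp S (\<lambda>n \<omega>. \<bar>X n \<omega>\<bar> \<le> \<epsilon>))"
proof safe
  fix \<epsilon> :: real assume X: "small_op S X" and "0 < \<epsilon>"
  then have lim: "(\<lambda>n. outer_measure_of S {\<omega> \<in> space S. \<epsilon> < \<bar>X n \<omega>\<bar>}) \<longlonglongrightarrow> 0"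
    unfolding small_op_def by blast
  show "whp S (\<lambda>n \<omega>. \<bar>X n \<omega>\<bar> \<le> \<epsilon>)"
    unfolding whp_def
  proof (intro allI impI)
    fix \<eta> :: real assume "0 < \<eta>"
    then have "\<forall>\<^sub>F n in sequentially. outer_measure_of S {\<omega> \<in> space S. \<epsilon> < \<bar>X n \<omega>\<bar>} < ennreal \<eta>"
      by (intro order_tendstoD(2)[OF lim]) simp
    then show "\<forall>\<^sub>F n in sequentially.
      \<exists>A\<in>sets S. emeasure S A \<le> ennreal \<eta> \<and> (\<forall>\<omega>\<in>space S - A. \<bar>X n \<omega>\<bar> \<le> \<epsilon>)"
    proof eventually_elim
      case (elim n)
      obtain E where "E \<in> sets S" "{\<omega> \<in> space S. \<epsilon> < \<bar>X n \<omega>\<bar>} \<subseteq> E"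
        "outer_measure_of S {\<omega> \<in> space S. \<epsilon> < \<bar>X n \<omega>\<bar>} = emeasure S E"
        using outer_measure_of_attain[of "{\<omega> \<in> space S. \<epsilon> < \<bar>X n \<omega>\<bar>}" S] by auto
      then show ?case using elim by (intro bexI[of _ E]) (auto simp: not_less)
    qed
  qed
next
  assume X: "\<forall>\<epsilon>>0. whp S (\<lambda>n \<omega>. \<bar>X n \<omega>\<bar> \<le> \<epsilon>)"
  show "small_op S X"
    unfolding small_op_def
  proof (intro allI impI)
    fix \<epsilon> :: real assume "0 < \<epsilon>"
    with X have w: "whp S (\<lambda>n \<omega>. \<bar>X n \<omega>\<bar> \<le> \<epsilon>)" by blast
    show "(\<lambda>n. outer_measure_of S {\<omega> \<in> space S. \<epsilon> < \<bar>X n \<omega>\<bar>}) \<longlonglongrightarrow> 0"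
    proof (rule order_tendstoI)
      fix c :: ennreal assume "0 < c"
      \<comment> \<open>The bound c lives in \<open>ennreal\<close> and may be infinite. A strictly
        smaller positive e is finite and so comes from a real \<eta>, as \<open>whp\<close>
        expects.\<close>
      then obtain e where e: "0 < e" "e < c" using dense by blast
      then obtain \<eta> where \<eta>: "e = ennreal \<eta>" "0 < \<eta>"
        by (cases e) (auto simp: ennreal_less_zero_iff)
      from whpD[OF w \<eta>(2)]
      show "\<forall>\<^sub>F n in sequentially. outer_measure_of S {\<omega> \<in> space S. \<epsilon> < \<bar>X n \<omega>\<bar>} < c"
      proof eventually_elim
        case (elim n)
        then obtain A where A: "A \<in> sets S" "emeasure S A \<le> e" "\<forall>\<omega>\<in>space S - A. \<bar>X n \<omega>\<bar> \<le> \<epsilon>"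
          using \<eta> by blast
        have "outer_measure_of S {\<omega> \<in> space S. \<epsilon> < \<bar>X n \<omega>\<bar>} \<le> outer_measure_of S A"
          using A(3) by (intro outer_measure_of_mono) force
        then show ?case using A e by simp
      qed
    qed simp
  qed
qed

definition conv_prob :: "'w measure \<Rightarrow> (nat \<Rightarrow> 'w \<Rightarrow> 'a::metric_space) \<Rightarrow> 'a \<Rightarrow> bool" where
  "conv_prob S X a \<longleftrightarrow> (\<forall>\<epsilon>>0. whp S (\<lambda>n \<omega>. dist (X n \<omega>) a < \<epsilon>))"

lemma conv_probD: "conv_prob S X a \<Longrightarrow> 0 < \<epsilon> \<Longrightarrow> whp S (\<lambda>n \<omega>. dist (X n \<omega>) a < \<epsilon>)"
  unfolding conv_prob_def by blast

lemma conv_prob_iff_small_op: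
  "conv_prob S X a \<longleftrightarrow> small_op S (\<lambda>n \<omega>. dist (X n \<omega>) a)"
proof -
  have "whp S (\<lambda>n \<omega>. dist (X n \<omega>) a < \<epsilon>)"
    if "0 < \<epsilon>" "\<And>\<epsilon>. 0 < \<epsilon> \<Longrightarrow> whp S (\<lambda>n \<omega>. dist (X n \<omega>) a \<le> \<epsilon>)" for \<epsilon> :: real
    using that(1) by (intro whp_mono[OF that(2)[of "\<epsilon> / 2"]]) auto
  moreover have "whp S (\<lambda>n \<omega>. dist (X n \<omega>) a \<le> \<epsilon>)"
    if "whp S (\<lambda>n \<omega>. dist (X n \<omega>) a < \<epsilon>)" for \<epsilon> :: real
    using that by (rule whp_mono) auto
  ultimately show ?thesis
    unfolding conv_prob_def small_op_iff_whp by auto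
qed

lemma conv_prob_Pair:
  assumes "conv_prob S X a" "conv_prob S Y b"
  shows "conv_prob S (\<lambda>n \<omega>. (X n \<omega>, Y n \<omega>)) (a, b)"
  unfolding conv_prob_def
proof (intro allI impI)
  fix \<epsilon> :: real assume "0 < \<epsilon>"
  then have "whp S (\<lambda>n \<omega>. dist (X n \<omega>) a < \<epsilon> / 2 \<and> dist (Y n \<omega>) b < \<epsilon> / 2)"
    using assms by (intro whp_conj conv_probD) auto
  then show "whp S (\<lambda>n \<omega>. dist (X n \<omega>, Y n \<omega>) (a, b) < \<epsilon>)"
  proof (rule whp_mono)
    fix n \<omega> assume "dist (X n \<omega>) a < \<epsilon> / 2 \<and> dist (Y n \<omega>) b < \<epsilon> / 2"
    moreover have "dist (X n \<omega>, Y n \<omega>) (a, b) \<le> dist (X n \<omega>) a + dist (Y n \<omega>) b"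
      using sqrt_sum_squares_le_sum_abs[of "dist (X n \<omega>) a" "dist (Y n \<omega>) b"]
      by (simp add: dist_Pair_Pair)
    ultimately show "dist (X n \<omega>, Y n \<omega>) (a, b) < \<epsilon>" by linarith
  qed
qed

text \<open>Continuity is asked at the limit only. This matters for \<open>pinv\<close>, which is
  discontinuous at singular square matrices.\<close>

lemma conv_prob_isCont:
  assumes "conv_prob S X a" "isCont g a"
  shows "conv_prob S (\<lambda>n \<omega>. g (X n \<omega>)) (g a)"
  unfolding conv_prob_def
proof (intro allI impI)
  fix \<epsilon> :: real assume "0 < \<epsilon>"
  then obtain d where "0 < d" "\<And>y. dist y a < d \<Longrightarrow> dist (g y) (g a) < \<epsilon>"
    using assms(2) unfolding continuous_at_eps_delta by blast
  then show "whp S (\<lambda>n \<omega>. dist (g (X n \<omega>)) (g a) < \<epsilon>)"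
    by (intro whp_mono[OF conv_probD[OF assms(1)]]) auto
qed

section \<open>Empirical means\<close>

lemma emp_diff: "emp \<xi> n \<omega> (\<lambda>x. f x - g x) = emp \<xi> n \<omega> f - emp \<xi> n \<omega> g"
  unfolding emp_def by (simp add: sum_subtractf scaleR_diff_right)

lemma emp_mult_right: "emp \<xi> n \<omega> (\<lambda>x. f x * c) = emp \<xi> n \<omega> f * (c::real)"
  unfolding emp_def by (simp add: sum_distrib_right mult.assoc)

lemma norm_emp_le:
  assumes "\<And>i. i < n \<Longrightarrow> norm (f (\<xi> i \<omega>)) \<le> g (\<xi> i \<omega>)"
  shows "norm (emp \<xi> n \<omega> f) \<le> emp \<xi> n \<omega> g"
proof -
  have "norm (emp \<xi> n \<omega> f) = (1 / real n) * norm (\<Sum>i<n. f (\<xi> i \<omega>))"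
    unfolding emp_def by simp
  also have "\<dots> \<le> (1 / real n) * (\<Sum>i<n. g (\<xi> i \<omega>))"
    using assms by (intro mult_left_mono order_trans[OF norm_sum] sum_mono) auto
  finally show ?thesis unfolding emp_def by simp
qed

lemma emp_inner: "emp \<xi> n \<omega> (\<lambda>x. f x \<bullet> b) = emp \<xi> n \<omega> f \<bullet> b"
  unfolding emp_def by (simp add: inner_sum_left)

section \<open>Laws of large numbers for an i.i.d. sample\<close>

locale iid =
  fixes P :: "'x measure" and S :: "'w measure" and \<xi> :: "nat \<Rightarrow> 'w \<Rightarrow> 'x"
  assumes iid: "iid_sample S P \<xi>"
begin

sublocale S: prob_space S
  using iid unfolding iid_sample_def by blast

lemma measurable_sample [measurable]: "\<xi> i \<in> S \<rightarrow>\<^sub>M P"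
  using iid unfolding iid_sample_def S.indep_vars_def by blast

lemma distr_sample: "distr S P (\<xi> i) = P"
  using iid unfolding iid_sample_def by blast

lemma prob_space_population: "prob_space P"
  using S.prob_space_distr[OF measurable_sample, of 0] distr_sample by simp

sublocale P: prob_space P
  by (rule prob_space_population)

text \<open>The null set is pulled back along each \<open>\<xi> i\<close>, and the countably many
  preimages are united. An almost sure bound on the integrand thus holds at all sample points at
  once, for every n.\<close>

lemma AE_sample:
  assumes "AE x in P. Q x"
  shows "AE \<omega> in S. \<forall>i. Q (\<xi> i \<omega>)"
proof -
  have "AE \<omega> in S. Q (\<xi> i \<omega>)" for i
  proof (rule AE_distrD[OF measurable_sample])
    show "AE x in distr S P (\<xi> i). Q x"
      unfolding distr_sample by (rule assms)
  qed
  then show ?thesis by (simp add: AE_all_countable)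
qed

lemma whp_sample:
  assumes "AE x in P. Q x"
  shows "whp S (\<lambda>n \<omega>. \<forall>i. Q (\<xi> i \<omega>))"
  by (rule whp_AE) (simp add: AE_sample[OF assms])

lemma integral_emp:
  fixes f :: "'x \<Rightarrow> real"
  assumes "integrable P f" "0 < n"
  shows "integrable S (\<lambda>\<omega>. emp \<xi> n \<omega> f)" "(\<integral>\<omega>. emp \<xi> n \<omega> f \<partial>S) = (\<integral>x. f x \<partial>P)"
proof -
  have f: "f \<in> borel_measurable P" using assms by simp
  have i: "integrable S (\<lambda>\<omega>. f (\<xi> i \<omega>))" for i
    using assms(1) integrable_distr_eq[OF measurable_sample f, of i] by (simp add: distr_sample)
  have e: "(\<integral>\<omega>. f (\<xi> i \<omega>) \<partial>S) = (\<integral>x. f x \<partial>P)" for i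
    using integral_distr[OF measurable_sample f, of i] by (simp add: distr_sample)
  show "integrable S (\<lambda>\<omega>. emp \<xi> n \<omega> f)"
    unfolding emp_def using i by simp
  show "(\<integral>\<omega>. emp \<xi> n \<omega> f \<partial>S) = (\<integral>x. f x \<partial>P)"
    unfolding emp_def using i e assms(2) by (simp add: Bochner_Integration.integral_sum)
qed

text \<open>Hoeffding's inequality gives an exponential tail bound for each n, and the bound tends
  to 0.\<close>

lemma weak_law_bounded:
  fixes f :: "'x \<Rightarrow> real"
  assumes [measurable]: "f \<in> borel_measurable P" and bd: "\<And>x. \<bar>f x\<bar> \<le> B"
  shows "conv_prob S (\<lambda>n \<omega>. emp \<xi> n \<omega> f) (\<integral>x. f x \<partial>P)"
  unfolding conv_prob_def whp_def
proof (intro allI impI)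
  fix \<epsilon> \<eta> :: real assume pos: "0 < \<epsilon>" "0 < \<eta>"
  \<comment> \<open>B may be 0, as for f = 0, but the interval [-C, C] in Hoeffding's inequality
    must have positive length.\<close>
  define C where "C = B + 1"
  have C: "0 < C" "\<And>x. \<bar>f x\<bar> \<le> C"
  proof -
    show "0 < C" using order_trans[OF abs_ge_zero bd] unfolding C_def by simp
    show "\<bar>f x\<bar> \<le> C" for x using bd[of x] unfolding C_def by simp
  qed
  have distr_f: "distr S borel (\<lambda>\<omega>. f (\<xi> i \<omega>)) = distr P borel f" for i
    using distr_distr[of f P borel "\<xi> i" S] by (simp add: distr_sample o_def)
  have bnd: "S.prob {\<omega>\<in>space S. \<epsilon> \<le> \<bar>emp \<xi> n \<omega> f - (\<integral>x. f x \<partial>P)\<bar>}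
      \<le> 2 * exp (- 2 * real n * \<epsilon>\<^sup>2 / (C - - C)\<^sup>2)" if "0 < n" for n
  proof -
    interpret H: Hoeffding_ineq_iid S "{..<n}" "\<lambda>i \<omega>. f (\<xi> i \<omega>)" "\<lambda>\<omega>. f (\<xi> 0 \<omega>)" "- C" C
      "S.expectation (\<lambda>\<omega>. f (\<xi> 0 \<omega>))"
    proof unfold_locales
      have "S.indep_vars (\<lambda>_. P) \<xi> {..<n}"
        using iid unfolding iid_sample_def by (auto intro: S.indep_vars_subset)
      then show "S.indep_vars (\<lambda>_. borel) (\<lambda>i \<omega>. f (\<xi> i \<omega>)) {..<n}"
        by (rule S.indep_vars_compose2) simp
      show "AE \<omega> in S. f (\<xi> 0 \<omega>) \<in> {- C..C}"
        using C(2) by (auto simp: abs_le_iff minus_le_iff)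
    qed (auto simp: distr_f)
    have "S.expectation (\<lambda>\<omega>. f (\<xi> 0 \<omega>)) = (\<integral>x. f x \<partial>P)"
      using integral_distr[OF measurable_sample, of f 0] by (simp add: distr_sample)
    then show ?thesis
      using H.Hoeffding_ineq_abs_ge'[of \<epsilon>] pos C(1) that
      unfolding emp_def by (simp only: card_lessThan less_imp_le minus_less_iff
        lessThan_empty_iff neq0_conv real_scaleR_def mult_1 times_divide_eq_left)
  qed
  have "(\<lambda>n. 2 * exp (- 2 * real n * \<epsilon>\<^sup>2 / (C - - C)\<^sup>2)) \<longlonglongrightarrow> 0"
  proof -
    have "0 < 2 * \<epsilon>\<^sup>2 / (C - - C)\<^sup>2"
      using pos C(1) by (intro divide_pos_pos) auto
    then have "(\<lambda>n. exp (- (2 * \<epsilon>\<^sup>2 / (C - - C)\<^sup>2)) ^ n) \<longlonglongrightarrow> 0"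
      by (intro LIMSEQ_power_zero) (simp only: exp_less_one_iff real_norm_def abs_exp_cancel neg_less_0_iff_less)
    then have "(\<lambda>n. 2 * exp (- (2 * \<epsilon>\<^sup>2 / (C - - C)\<^sup>2)) ^ n) \<longlonglongrightarrow> 2 * 0"
      by (rule tendsto_mult_left)
    moreover have "exp (- (2 * \<epsilon>\<^sup>2 / (C - - C)\<^sup>2)) ^ n = exp (- 2 * real n * \<epsilon>\<^sup>2 / (C - - C)\<^sup>2)" for n
      by (subst exp_of_nat_mult[symmetric]) (simp add: algebra_simps)
    ultimately show ?thesis by simp
  qed
  then have "\<forall>\<^sub>F n in sequentially. 2 * exp (- 2 * real n * \<epsilon>\<^sup>2 / (C - - C)\<^sup>2) < \<eta>"
    using pos by (intro order_tendstoD(2)) auto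
  then show "\<forall>\<^sub>F n in sequentially. \<exists>A\<in>sets S. emeasure S A \<le> ennreal \<eta> \<and>
      (\<forall>\<omega>\<in>space S - A. dist (emp \<xi> n \<omega> f) (\<integral>x. f x \<partial>P) < \<epsilon>)"
    using eventually_gt_at_top[of 0]
  proof eventually_elim
    case (elim n)
    have "{\<omega>\<in>space S. \<epsilon> \<le> \<bar>emp \<xi> n \<omega> f - (\<integral>x. f x \<partial>P)\<bar>} \<in> sets S"
      unfolding emp_def by measurable
    then show ?case
      using bnd[OF elim(2)] elim(1) pos
      by (intro bexI[of _ "{\<omega>\<in>space S. \<epsilon> \<le> \<bar>emp \<xi> n \<omega> f - (\<integral>x. f x \<partial>P)\<bar>}"])
        (auto simp: S.emeasure_eq_measure dist_real_def not_le)
  qed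
qed

text \<open>A first moment gives no variance bound, hence truncation: the bounded part obeys
  \<open>weak_law_bounded\<close>, and the remainder, small in mean, is controlled by Markov's
  inequality.\<close>

lemma weak_law_real:
  fixes f :: "'x \<Rightarrow> real"
  assumes int: "integrable P f"
  shows "conv_prob S (\<lambda>n \<omega>. emp \<xi> n \<omega> f) (\<integral>x. f x \<partial>P)"
  unfolding conv_prob_def whp_def
proof (intro allI impI)
  fix \<epsilon> \<eta> :: real assume pos: "0 < \<epsilon>" "0 < \<eta>"
  have [measurable]: "f \<in> borel_measurable P" using int by simp
  define g where "g k x = (if \<bar>f x\<bar> \<le> real k then f x else 0)" for k x
  have g_meas [measurable]: "g k \<in> borel_measurable P" for k
    unfolding g_def by measurable
  have "(\<lambda>k. \<integral>x. \<bar>f x - g k x\<bar> \<partial>P) \<longlonglongrightarrow> (\<integral>x. 0 \<partial>P)"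
  proof (rule integral_dominated_convergence)
    show "AE x in P. (\<lambda>k. \<bar>f x - g k x\<bar>) \<longlonglongrightarrow> 0"
    proof (rule AE_I2, rule tendsto_eventually)
      fix x
      show "\<forall>\<^sub>F k in sequentially. \<bar>f x - g k x\<bar> = 0"
        using eventually_ge_at_top[of "nat \<lceil>\<bar>f x\<bar>\<rceil>"]
        by eventually_elim (auto simp: g_def le_nat_iff nat_le_iff ceiling_le_iff)
    qed
    show "integrable P (\<lambda>x. \<bar>f x\<bar>)" using int by simp
  qed (auto simp: g_def)
  \<comment> \<open>The first bound is for the bias that truncation causes in the mean. The second
    makes Markov's inequality at level \<epsilon>/3 yield probability at most \<eta>/2.\<close>
  then have "\<forall>\<^sub>F k in sequentially. (\<integral>x. \<bar>f x - g k x\<bar> \<partial>P) < min (\<epsilon> / 3) (\<epsilon> / 3 * (\<eta> / 2))"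
    using pos by (intro order_tendstoD(2)[of _ 0]) auto
  then obtain k where k: "(\<integral>x. \<bar>f x - g k x\<bar> \<partial>P) < \<epsilon> / 3" "(\<integral>x. \<bar>f x - g k x\<bar> \<partial>P) < \<epsilon> / 3 * (\<eta> / 2)"
    by (auto simp: eventually_sequentially)
  have int_g: "integrable P (g k)"
    by (rule Bochner_Integration.integrable_bound[OF int]) (auto simp: g_def)
  then have int_d: "integrable P (\<lambda>x. \<bar>f x - g k x\<bar>)" using int by simp
  have mean: "\<bar>(\<integral>x. g k x \<partial>P) - (\<integral>x. f x \<partial>P)\<bar> < \<epsilon> / 3"
  proof -
    have "\<bar>(\<integral>x. f x \<partial>P) - (\<integral>x. g k x \<partial>P)\<bar> = \<bar>\<integral>x. f x - g k x \<partial>P\<bar>"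
      using int int_g by simp
    also have "\<dots> \<le> (\<integral>x. \<bar>f x - g k x\<bar> \<partial>P)"
      using integral_norm_bound[of P "\<lambda>x. f x - g k x"] by simp
    finally show ?thesis using k(1) by linarith
  qed
  have "conv_prob S (\<lambda>n \<omega>. emp \<xi> n \<omega> (g k)) (\<integral>x. g k x \<partial>P)"
    by (rule weak_law_bounded[of _ "real k"]) (auto simp: g_def)
  then have "whp S (\<lambda>n \<omega>. dist (emp \<xi> n \<omega> (g k)) (\<integral>x. g k x \<partial>P) < \<epsilon> / 3)"
    using pos by (intro conv_probD) auto
  from whpD[OF this, of "\<eta> / 2"] pos(2) 
  have "\<forall>\<^sub>F n in sequentially. \<exists>A\<in>sets S. emeasure S A \<le> ennreal (\<eta> / 2) \<and>
      (\<forall>\<omega>\<in>space S - A. dist (emp \<xi> n \<omega> (g k)) (\<integral>x. g k x \<partial>P) < \<epsilon> / 3)"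
    by simp
  then show "\<forall>\<^sub>F n in sequentially. \<exists>A\<in>sets S. emeasure S A \<le> ennreal \<eta> \<and>
      (\<forall>\<omega>\<in>space S - A. dist (emp \<xi> n \<omega> f) (\<integral>x. f x \<partial>P) < \<epsilon>)"
    using eventually_gt_at_top[of 0]
  proof eventually_elim
    case (elim n)
    then obtain A where A: "A \<in> sets S" "emeasure S A \<le> ennreal (\<eta> / 2)"
      "\<forall>\<omega>\<in>space S - A. dist (emp \<xi> n \<omega> (g k)) (\<integral>x. g k x \<partial>P) < \<epsilon> / 3" by blast
    define B where "B = {\<omega>\<in>space S. \<epsilon> / 3 \<le> emp \<xi> n \<omega> (\<lambda>x. \<bar>f x - g k x\<bar>)}"
    have B [measurable]: "B \<in> sets S" unfolding B_def emp_def by measurable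
    have "measure S B \<le> (\<integral>\<omega>. emp \<xi> n \<omega> (\<lambda>x. \<bar>f x - g k x\<bar>) \<partial>S) / (\<epsilon> / 3)"
      unfolding B_def
    proof (rule integral_Markov_inequality_measure[OF integral_emp(1)[OF int_d elim(2)]])
      show "AE \<omega> in S. 0 \<le> emp \<xi> n \<omega> (\<lambda>x. \<bar>f x - g k x\<bar>)"
        by (intro AE_I2) (simp add: emp_def sum_nonneg)
      show "{} \<in> sets S" by simp
      show "0 < \<epsilon> / 3" using pos by simp
    qed
    also have "\<dots> \<le> \<eta> / 2"
      using k(2) pos by (simp add: integral_emp(2)[OF int_d elim(2)] field_simps)
    finally have "emeasure S B \<le> ennreal (\<eta> / 2)"
      unfolding S.emeasure_eq_measure by (rule ennreal_leI)
    then have "emeasure S (A \<union> B) \<le> ennreal (\<eta> / 2) + ennreal (\<eta> / 2)"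
      using A by (intro order_trans[OF emeasure_subadditive[OF A(1) B]] add_mono)
    then have le: "emeasure S (A \<union> B) \<le> ennreal \<eta>"
      using pos by (simp flip: ennreal_plus)
    have "dist (emp \<xi> n \<omega> f) (\<integral>x. f x \<partial>P) < \<epsilon>" if "\<omega> \<in> space S - (A \<union> B)" for \<omega>
    proof -
      have "\<bar>emp \<xi> n \<omega> f - emp \<xi> n \<omega> (g k)\<bar> < \<epsilon> / 3"
        using norm_emp_le[of n "\<lambda>x. f x - g k x" \<xi> \<omega> "\<lambda>x. \<bar>f x - g k x\<bar>"] that
        unfolding B_def by (auto simp: emp_diff)
      moreover have "\<bar>emp \<xi> n \<omega> (g k) - (\<integral>x. g k x \<partial>P)\<bar> < \<epsilon> / 3"
        using A(3) that by (simp add: dist_real_def)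
      ultimately show ?thesis using mean unfolding dist_real_def by linarith
    qed
    then show ?case using le A(1) B by (intro bexI[of _ "A \<union> B"]) auto
  qed
qed

lemma weak_law:
  fixes f :: "'x \<Rightarrow> 'b::euclidean_space"
  assumes int: "integrable P f"
  shows "conv_prob S (\<lambda>n \<omega>. emp \<xi> n \<omega> f) (\<integral>x. f x \<partial>P)"
  unfolding conv_prob_def
proof (intro allI impI)
  fix \<epsilon> :: real assume "0 < \<epsilon>"
  define d where "d = \<epsilon> / DIM('b)"
  have "0 < d" using \<open>0 < \<epsilon>\<close> by (simp add: d_def)
  have "whp S (\<lambda>n \<omega>. \<forall>b\<in>Basis. dist (emp \<xi> n \<omega> (\<lambda>x. f x \<bullet> b)) (\<integral>x. f x \<bullet> b \<partial>P) < d)"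
    using int \<open>0 < d\<close> by (intro whp_ball_finite conv_probD weak_law_real) auto
  then show "whp S (\<lambda>n \<omega>. dist (emp \<xi> n \<omega> f) (\<integral>x. f x \<partial>P) < \<epsilon>)"
  proof (rule whp_mono)
    fix n \<omega> assume *: "\<forall>b\<in>Basis. dist (emp \<xi> n \<omega> (\<lambda>x. f x \<bullet> b)) (\<integral>x. f x \<bullet> b \<partial>P) < d"
    have "dist (emp \<xi> n \<omega> f) (\<integral>x. f x \<partial>P)
      \<le> (\<Sum>b\<in>Basis. \<bar>(emp \<xi> n \<omega> f - (\<integral>x. f x \<partial>P)) \<bullet> b\<bar>)"
      unfolding dist_norm by (rule norm_le_l1)
    also have "\<dots> < (\<Sum>b\<in>(Basis :: 'b set). d)"
      using * int by (intro sum_strict_mono) (auto simp: emp_inner dist_real_def inner_diff_left)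
    also have "\<dots> = \<epsilon>" by (simp add: d_def)
    finally show "dist (emp \<xi> n \<omega> f) (\<integral>x. f x \<partial>P) < \<epsilon>" .
  qed
qed

end

section \<open>Families with measurable moduli of continuity\<close>

text \<open>On an open set a continuous function has the same supremum as on the points of a
  countable dense set, and the supremum over countably many measurable functions is measurable. R is
  defined by the dense set for every x, so it stays measurable even if continuity holds for almost
  every x only.\<close>

lemma measurable_SUP_continuous:
  fixes h :: "'a::second_countable_topology \<Rightarrow> 'x \<Rightarrow> real"
  assumes "open U" and meas: "\<And>\<theta>. \<theta> \<in> U \<Longrightarrow> h \<theta> \<in> borel_measurable P"
  obtains R :: "'x \<Rightarrow> ennreal" where "R \<in> borel_measurable P"
    "\<And>x. continuous_on U (\<lambda>\<theta>. h \<theta> x) \<Longrightarrow> R x = (SUP \<theta>\<in>U. ennreal (h \<theta> x))"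
proof -
  obtain D :: "'a set" where D: "countable D" "\<And>V. open V \<Longrightarrow> V \<noteq> {} \<Longrightarrow> \<exists>d\<in>D. d \<in> V"
    using countable_dense_exists[where 'a='a] by meson
  define R where "R x = (SUP \<theta>\<in>D \<inter> U. ennreal (h \<theta> x))" for x
  show ?thesis
  proof
    show "R \<in> borel_measurable P"
      unfolding R_def using D(1) meas by (intro borel_measurable_SUP) auto
    fix x assume cont: "continuous_on U (\<lambda>\<theta>. h \<theta> x)"
    show "R x = (SUP \<theta>\<in>U. ennreal (h \<theta> x))"
    proof (rule antisym)
      show "R x \<le> (SUP \<theta>\<in>U. ennreal (h \<theta> x))"
        unfolding R_def by (rule SUP_subset_mono) auto
      show "(SUP \<theta>\<in>U. ennreal (h \<theta> x)) \<le> R x"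
      proof (rule SUP_least, rule ccontr)
        fix \<theta> assume "\<theta> \<in> U" "\<not> ennreal (h \<theta> x) \<le> R x"
        \<comment> \<open>If the value at \<theta> exceeded R x, this set would be open and nonempty
          and would contain a point of D.\<close>
        have "open (U \<inter> (\<lambda>\<theta>. ennreal (h \<theta> x)) -` {R x<..})"
          using cont \<open>open U\<close> by (intro continuous_open_preimage continuous_on_ennreal) auto
        moreover have "\<theta> \<in> U \<inter> (\<lambda>\<theta>. ennreal (h \<theta> x)) -` {R x<..}"
          using \<open>\<theta> \<in> U\<close> \<open>\<not> ennreal (h \<theta> x) \<le> R x\<close> by auto
        ultimately obtain d where "d \<in> D" "d \<in> U" "R x < ennreal (h d x)"
          using D(2) by blast
        moreover have "ennreal (h d x) \<le> R x"
          unfolding R_def using \<open>d \<in> D\<close> \<open>d \<in> U\<close> by (intro SUP_upper) auto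
        ultimately show False by simp
      qed
    qed
  qed
qed

text \<open>The supremum is handed on by its two order properties: as an upper bound it dominates
  oscillations, and by minimality it inherits envelopes and limits. Minimality is restricted to b >=
  0 because R is nonnegative, also where all values of h are negative.\<close>

lemma measurable_sup_continuous_AE:
  fixes h :: "'a::second_countable_topology \<Rightarrow> 'x \<Rightarrow> real"
  assumes "open U" and meas: "\<And>\<theta>. \<theta> \<in> U \<Longrightarrow> h \<theta> \<in> borel_measurable P"
    and cont: "AE x in P. continuous_on U (\<lambda>\<theta>. h \<theta> x)"
    and bdd: "AE x in P. \<exists>b. \<forall>\<theta>\<in>U. h \<theta> x \<le> b"
  obtains R :: "'x \<Rightarrow> real" where "R \<in> borel_measurable P" "\<And>x. 0 \<le> R x"
    "AE x in P. (\<forall>\<theta>\<in>U. h \<theta> x \<le> R x) \<and> (\<forall>b\<ge>0. (\<forall>\<theta>\<in>U. h \<theta> x \<le> b) \<longrightarrow> R x \<le> b)"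
proof -
  obtain R where R [measurable]: "R \<in> borel_measurable P"
    and eq: "\<And>x. continuous_on U (\<lambda>\<theta>. h \<theta> x) \<Longrightarrow> R x = (SUP \<theta>\<in>U. ennreal (h \<theta> x))"
    using measurable_SUP_continuous[where h=h and P=P, OF assms(1) meas] by blast
  show ?thesis
  proof
    show "(\<lambda>x. enn2real (R x)) \<in> borel_measurable P" by measurable
    show "0 \<le> enn2real (R x)" for x by simp
    show "AE x in P. (\<forall>\<theta>\<in>U. h \<theta> x \<le> enn2real (R x)) \<and>
      (\<forall>b\<ge>0. (\<forall>\<theta>\<in>U. h \<theta> x \<le> b) \<longrightarrow> enn2real (R x) \<le> b)"
      using cont bdd
    proof eventually_elim
      case (elim x)
      have le: "R x \<le> ennreal b" if "\<And>\<theta>. \<theta> \<in> U \<Longrightarrow> h \<theta> x \<le> b" for b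
        unfolding eq[OF elim(1)] using that by (intro SUP_least ennreal_leI) auto
      obtain b where b: "\<forall>\<theta>\<in>U. h \<theta> x \<le> b" using elim(2) by blast
      \<comment> \<open>\<open>enn2real\<close> maps infinity to 0, so finiteness must be known
        before its value can serve as an upper bound.\<close>
      have fin: "R x < top" using le[of b] b by (simp add: ennreal_less_top le_less_trans)
      show ?case
      proof safe
        fix \<theta> assume "\<theta> \<in> U"
        then have "ennreal (h \<theta> x) \<le> R x" unfolding eq[OF elim(1)] by (rule SUP_upper)
        then show "h \<theta> x \<le> enn2real (R x)"
          using fin enn2real_mono[of "ennreal (h \<theta> x)" "R x"] enn2real_nonneg[of "R x"]
          by (cases "0 \<le> h \<theta> x") (simp, linarith)
      next
        fix b assume "0 \<le> b" "\<forall>\<theta>\<in>U. h \<theta> x \<le> b"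
        then show "enn2real (R x) \<le> b" using le[of b] by (auto intro: enn2real_leI)
      qed
    qed
  qed
qed

text \<open>The quantifiers matter: the radius \<open>\<delta>\<close> does not depend on \<open>x\<close>, and the modulus \<open>\<rho> k\<close>
  is measurable even though the oscillation of \<open>f\<close> over a ball need not be.\<close>

definition loc_dominated ::
  "'x measure \<Rightarrow> nat \<Rightarrow> 'a::metric_space \<Rightarrow> ('a \<Rightarrow> 'x \<Rightarrow> 'b::euclidean_space) \<Rightarrow> bool" where
  "loc_dominated P p a f \<longleftrightarrow> f a \<in> borel_measurable P \<and>
     (\<exists>F \<rho>. F \<in> borel_measurable P \<and> integrable P (\<lambda>x. F x ^ p) \<and>
        (\<forall>k. \<rho> k \<in> borel_measurable P) \<and>
        (\<forall>k::nat. \<exists>\<delta>>0. AE x in P. \<forall>\<theta>. dist \<theta> a < \<delta> \<longrightarrow> norm (f \<theta> x - f a x) \<le> \<rho> k x) \<and>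
        (AE x in P. norm (f a x) \<le> F x \<and> (\<forall>k. 0 \<le> \<rho> k x \<and> \<rho> k x \<le> F x) \<and> (\<lambda>k. \<rho> k x) \<longlonglongrightarrow> 0))"

lemma loc_dominatedI:
  assumes "f a \<in> borel_measurable P" "F \<in> borel_measurable P" "integrable P (\<lambda>x. F x ^ p)"
    and "\<And>k. \<rho> k \<in> borel_measurable P"
    and "\<And>k::nat. \<exists>\<delta>>0. AE x in P. \<forall>\<theta>. dist \<theta> a < \<delta> \<longrightarrow> norm (f \<theta> x - f a x) \<le> \<rho> k x"
    and "AE x in P. norm (f a x) \<le> F x \<and> (\<forall>k. 0 \<le> \<rho> k x \<and> \<rho> k x \<le> F x) \<and> (\<lambda>k. \<rho> k x) \<longlonglongrightarrow> 0"
  shows "loc_dominated P p a f"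
  using assms unfolding loc_dominated_def by blast

lemma loc_dominatedE:
  assumes "loc_dominated P p a f"
  obtains F \<rho> where "f a \<in> borel_measurable P" "F \<in> borel_measurable P" "integrable P (\<lambda>x. F x ^ p)"
    "\<And>k. \<rho> k \<in> borel_measurable P"
    "\<And>k::nat. \<exists>\<delta>>0. AE x in P. \<forall>\<theta>. dist \<theta> a < \<delta> \<longrightarrow> norm (f \<theta> x - f a x) \<le> \<rho> k x"
    "AE x in P. norm (f a x) \<le> F x \<and> (\<forall>k. 0 \<le> \<rho> k x \<and> \<rho> k x \<le> F x) \<and> (\<lambda>k. \<rho> k x) \<longlonglongrightarrow> 0"
proof -
  from assms obtain F \<rho> where "f a \<in> borel_measurable P \<and> F \<in> borel_measurable P \<and>
      integrable P (\<lambda>x. F x ^ p) \<and> (\<forall>k. \<rho> k \<in> borel_measurable P) \<and>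
      (\<forall>k::nat. \<exists>\<delta>>0. AE x in P. \<forall>\<theta>. dist \<theta> a < \<delta> \<longrightarrow> norm (f \<theta> x - f a x) \<le> \<rho> k x) \<and>
      (AE x in P. norm (f a x) \<le> F x \<and> (\<forall>k. 0 \<le> \<rho> k x \<and> \<rho> k x \<le> F x) \<and> (\<lambda>k. \<rho> k x) \<longlonglongrightarrow> 0)"
    unfolding loc_dominated_def by blast
  then show thesis by (intro that[of F \<rho>]) simp_all
qed

lemma radius_conj:
  fixes a :: "'a::metric_space"
  assumes "\<exists>\<delta>>0. AE x in P. \<forall>\<theta>. dist \<theta> a < \<delta> \<longrightarrow> A \<theta> x"
    and "\<exists>\<delta>>0. AE x in P. \<forall>\<theta>. dist \<theta> a < \<delta> \<longrightarrow> B \<theta> x"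
  shows "\<exists>\<delta>>0. AE x in P. \<forall>\<theta>. dist \<theta> a < \<delta> \<longrightarrow> A \<theta> x \<and> B \<theta> x"
proof -
  obtain d e where "0 < d" "AE x in P. \<forall>\<theta>. dist \<theta> a < d \<longrightarrow> A \<theta> x"
    and "0 < e" "AE x in P. \<forall>\<theta>. dist \<theta> a < e \<longrightarrow> B \<theta> x"
    using assms by blast
  then have "AE x in P. \<forall>\<theta>. dist \<theta> a < min d e \<longrightarrow> A \<theta> x \<and> B \<theta> x"
    by (auto elim: AE_mp)
  then show ?thesis using \<open>0 < d\<close> \<open>0 < e\<close> by (intro exI[of _ "min d e"]) auto
qed

lemma radius_mono:
  fixes a :: "'a::metric_space"
  assumes "\<exists>\<delta>>0. AE x in P. \<forall>\<theta>. dist \<theta> a < \<delta> \<longrightarrow> A \<theta> x"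
    and "AE x in P. \<forall>\<theta>. A \<theta> x \<longrightarrow> B \<theta> x"
  shows "\<exists>\<delta>>0. AE x in P. \<forall>\<theta>. dist \<theta> a < \<delta> \<longrightarrow> B \<theta> x"
proof -
  obtain d where "0 < d" "AE x in P. \<forall>\<theta>. dist \<theta> a < d \<longrightarrow> A \<theta> x" using assms by blast
  moreover from this(2) assms(2) have "AE x in P. \<forall>\<theta>. dist \<theta> a < d \<longrightarrow> B \<theta> x"
    by eventually_elim blast
  ultimately show ?thesis by blast
qed

text \<open>Comparing |F| with 1 gives |F|^p <= 1 + |F|^q pointwise, and the constant 1 is
  integrable for a probability measure.\<close>

lemma (in prob_space) integrable_power_le:
  fixes F :: "'a \<Rightarrow> real"
  assumes [measurable]: "F \<in> borel_measurable M" and "integrable M (\<lambda>x. F x ^ q)" "p \<le> q"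
  shows "integrable M (\<lambda>x. F x ^ p)"
proof (rule Bochner_Integration.integrable_bound[of _ "\<lambda>x. 1 + \<bar>F x ^ q\<bar>"])
  show "integrable M (\<lambda>x. 1 + \<bar>F x ^ q\<bar>)" using assms by simp
  show "AE x in M. norm (F x ^ p) \<le> norm (1 + \<bar>F x ^ q\<bar>)"
  proof (rule AE_I2)
    fix x
    have "\<bar>F x\<bar> ^ p \<le> 1 + \<bar>F x\<bar> ^ q"
    proof (cases "\<bar>F x\<bar> \<le> 1")
      case True
      then have "\<bar>F x\<bar> ^ p \<le> 1" by (simp add: power_le_one)
      then show ?thesis by (simp add: add_increasing2)
    next
      case False
      then have "\<bar>F x\<bar> ^ p \<le> \<bar>F x\<bar> ^ q" using assms(3) by (intro power_increasing) auto
      then show ?thesis by simp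
    qed
    then show "norm (F x ^ p) \<le> norm (1 + \<bar>F x ^ q\<bar>)"
      by (simp add: power_abs)
  qed
qed simp

lemma loc_dominated_power_le:
  assumes "prob_space P" "loc_dominated P q a f" "p \<le> q"
  shows "loc_dominated P p a f"
proof -
  interpret prob_space P by fact
  from assms(2) obtain F \<rho> where *: "f a \<in> borel_measurable P" "F \<in> borel_measurable P"
    "integrable P (\<lambda>x. F x ^ q)" "\<And>k. \<rho> k \<in> borel_measurable P"
    "\<And>k::nat. \<exists>\<delta>>0. AE x in P. \<forall>\<theta>. dist \<theta> a < \<delta> \<longrightarrow> norm (f \<theta> x - f a x) \<le> \<rho> k x"
    "AE x in P. norm (f a x) \<le> F x \<and> (\<forall>k. 0 \<le> \<rho> k x \<and> \<rho> k x \<le> F x) \<and> (\<lambda>k. \<rho> k x) \<longlonglongrightarrow> 0"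
    by (rule loc_dominatedE) blast
  show ?thesis
    by (rule loc_dominatedI[OF *(1,2) integrable_power_le[OF *(2,3) assms(3)] *(4-6)])
qed

lemma loc_dominated_integrable:
  assumes "loc_dominated P 1 a f"
  shows "integrable P (f a)"
proof -
  from assms obtain F \<rho> where *: "f a \<in> borel_measurable P" "F \<in> borel_measurable P"
    "integrable P (\<lambda>x. F x ^ 1)" "\<And>k. \<rho> k \<in> borel_measurable P"
    "\<And>k::nat. \<exists>\<delta>>0. AE x in P. \<forall>\<theta>. dist \<theta> a < \<delta> \<longrightarrow> norm (f \<theta> x - f a x) \<le> \<rho> k x"
    "AE x in P. norm (f a x) \<le> F x \<and> (\<forall>k. 0 \<le> \<rho> k x \<and> \<rho> k x \<le> F x) \<and> (\<lambda>k. \<rho> k x) \<longlonglongrightarrow> 0"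
    by (rule loc_dominatedE) blast
  show ?thesis
    by (rule Bochner_Integration.integrable_bound[OF *(3,1)]) (use *(6) in \<open>auto elim!: eventually_mono\<close>)
qed

text \<open>For g = \<open>fst\<close>, this moves a family in \<theta> to the parameter triple of
  \<open>conv_prob_plug_in\<close>. Continuity turns the radius around g b into one around b that is
  still independent of x.\<close>

lemma loc_dominated_compose:
  assumes "loc_dominated P p (g b) f" and "isCont g b"
  shows "loc_dominated P p b (\<lambda>\<eta>. f (g \<eta>))"
proof -
  from assms(1) obtain F \<rho> where *: "f (g b) \<in> borel_measurable P" "F \<in> borel_measurable P"
    "integrable P (\<lambda>x. F x ^ p)" "\<And>k. \<rho> k \<in> borel_measurable P"
    "\<And>k::nat. \<exists>\<delta>>0. AE x in P. \<forall>\<theta>. dist \<theta> (g b) < \<delta> \<longrightarrow> norm (f \<theta> x - f (g b) x) \<le> \<rho> k x"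
    "AE x in P. norm (f (g b) x) \<le> F x \<and> (\<forall>k. 0 \<le> \<rho> k x \<and> \<rho> k x \<le> F x) \<and> (\<lambda>k. \<rho> k x) \<longlonglongrightarrow> 0"
    by (rule loc_dominatedE) blast
  have "\<exists>\<delta>>0. AE x in P. \<forall>\<eta>. dist \<eta> b < \<delta> \<longrightarrow> norm (f (g \<eta>) x - f (g b) x) \<le> \<rho> k x" for k
  proof -
    obtain d where "0 < d"
      and d: "AE x in P. \<forall>\<theta>. dist \<theta> (g b) < d \<longrightarrow> norm (f \<theta> x - f (g b) x) \<le> \<rho> k x"
      using *(5)[of k] by blast
    then obtain e where "0 < e" "\<And>\<eta>. dist \<eta> b < e \<Longrightarrow> dist (g \<eta>) (g b) < d"
      using assms(2) unfolding continuous_at_eps_delta by blast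
    then show ?thesis using d by (intro exI[of _ e]) (auto elim!: eventually_mono)
  qed
  then show ?thesis by (rule loc_dominatedI[where f="\<lambda>\<eta>. f (g \<eta>)", OF *(1-4) _ *(6)])
qed

lemma loc_dominated_add:
  assumes "loc_dominated P 2 a f" "loc_dominated P 2 a g"
  shows "loc_dominated P 2 a (\<lambda>\<theta> x. f \<theta> x + g \<theta> x)"
proof -
  from assms(1) obtain F \<rho> where f: "f a \<in> borel_measurable P" "F \<in> borel_measurable P"
    "integrable P (\<lambda>x. F x ^ 2)" "\<And>k. \<rho> k \<in> borel_measurable P"
    "\<And>k::nat. \<exists>\<delta>>0. AE x in P. \<forall>\<theta>. dist \<theta> a < \<delta> \<longrightarrow> norm (f \<theta> x - f a x) \<le> \<rho> k x"
    "AE x in P. norm (f a x) \<le> F x \<and> (\<forall>k. 0 \<le> \<rho> k x \<and> \<rho> k x \<le> F x) \<and> (\<lambda>k. \<rho> k x) \<longlonglongrightarrow> 0"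
    by (rule loc_dominatedE) blast
  from assms(2) obtain G \<sigma> where g: "g a \<in> borel_measurable P" "G \<in> borel_measurable P"
    "integrable P (\<lambda>x. G x ^ 2)" "\<And>k. \<sigma> k \<in> borel_measurable P"
    "\<And>k::nat. \<exists>\<delta>>0. AE x in P. \<forall>\<theta>. dist \<theta> a < \<delta> \<longrightarrow> norm (g \<theta> x - g a x) \<le> \<sigma> k x"
    "AE x in P. norm (g a x) \<le> G x \<and> (\<forall>k. 0 \<le> \<sigma> k x \<and> \<sigma> k x \<le> G x) \<and> (\<lambda>k. \<sigma> k x) \<longlonglongrightarrow> 0"
    by (rule loc_dominatedE) blast
  note [measurable] = f(1,2,4) g(1,2,4)
  show ?thesis
  proof (rule loc_dominatedI[where F="\<lambda>x. F x + G x" and \<rho>="\<lambda>k x. \<rho> k x + \<sigma> k x"])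
    show "integrable P (\<lambda>x. (F x + G x) ^ 2)"
    proof (rule Bochner_Integration.integrable_bound)
      show "integrable P (\<lambda>x. 2 * F x ^ 2 + 2 * G x ^ 2)" using f(3) g(3) by simp
      have "(F x + G x)\<^sup>2 \<le> 2 * (F x)\<^sup>2 + 2 * (G x)\<^sup>2" for x
        using sum_squares_bound[of "F x" "G x"] by (simp add: power2_sum)
      then show "AE x in P. norm ((F x + G x)\<^sup>2) \<le> norm (2 * (F x)\<^sup>2 + 2 * (G x)\<^sup>2)" by simp
    qed simp
    show "\<exists>\<delta>>0. AE x in P. \<forall>\<theta>. dist \<theta> a < \<delta> \<longrightarrow>
        norm (f \<theta> x + g \<theta> x - (f a x + g a x)) \<le> \<rho> k x + \<sigma> k x" for k
    proof (rule radius_mono[OF radius_conj[OF f(5)[of k] g(5)[of k]]], rule AE_I2, safe)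
      fix x \<theta> assume "norm (f \<theta> x - f a x) \<le> \<rho> k x" "norm (g \<theta> x - g a x) \<le> \<sigma> k x"
      then show "norm (f \<theta> x + g \<theta> x - (f a x + g a x)) \<le> \<rho> k x + \<sigma> k x"
        by (subst add_diff_add) (rule norm_triangle_mono)
    qed
    show "AE x in P. norm (f a x + g a x) \<le> F x + G x \<and>
       (\<forall>k. 0 \<le> \<rho> k x + \<sigma> k x \<and> \<rho> k x + \<sigma> k x \<le> F x + G x) \<and> (\<lambda>k. \<rho> k x + \<sigma> k x) \<longlonglongrightarrow> 0"
      using f(6) g(6)
    proof eventually_elim
      case (elim x)
      then show ?case
        using tendsto_add[of "\<lambda>k. \<rho> k x" 0 sequentially "\<lambda>k. \<sigma> k x" 0]
        by (simp add: norm_triangle_mono add_mono)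
    qed
  qed simp_all
qed

text \<open>Shared by \<open>loc_dominated_bilinear\<close>, where both factors depend on x, and
  \<open>loc_dominated_bilinear_param\<close>, where one is deterministic; hence integrability is
  assumed of the product F * G and not of the separate factors.\<close>

lemma loc_dominated_bilinear_envelope:
  fixes a :: "'a::metric_space"
    and f :: "'a \<Rightarrow> 'x \<Rightarrow> 'b::euclidean_space" and g :: "'a \<Rightarrow> 'x \<Rightarrow> 'c::euclidean_space"
    and bop :: "'b \<Rightarrow> 'c \<Rightarrow> 'e::euclidean_space"
  assumes "bounded_bilinear bop"
    and f: "f a \<in> borel_measurable P" "F \<in> borel_measurable P" "\<And>k. \<rho> k \<in> borel_measurable P"
      "\<And>k::nat. \<exists>\<delta>>0. AE x in P. \<forall>\<theta>. dist \<theta> a < \<delta> \<longrightarrow> norm (f \<theta> x - f a x) \<le> \<rho> k x"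
      "AE x in P. norm (f a x) \<le> F x \<and> (\<forall>k. 0 \<le> \<rho> k x \<and> \<rho> k x \<le> F x) \<and> (\<lambda>k. \<rho> k x) \<longlonglongrightarrow> 0"
    and g: "g a \<in> borel_measurable P" "G \<in> borel_measurable P" "\<And>k. \<sigma> k \<in> borel_measurable P"
      "\<And>k::nat. \<exists>\<delta>>0. AE x in P. \<forall>\<theta>. dist \<theta> a < \<delta> \<longrightarrow> norm (g \<theta> x - g a x) \<le> \<sigma> k x"
      "AE x in P. norm (g a x) \<le> G x \<and> (\<forall>k. 0 \<le> \<sigma> k x \<and> \<sigma> k x \<le> G x) \<and> (\<lambda>k. \<sigma> k x) \<longlonglongrightarrow> 0"
    and int: "integrable P (\<lambda>x. (F x * G x) ^ p)"
  shows "loc_dominated P p a (\<lambda>\<theta> x. bop (f \<theta> x) (g \<theta> x))"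
proof -
  interpret bounded_bilinear bop by fact
  obtain K where K: "0 < K" "\<And>u v. norm (bop u v) \<le> norm u * norm v * K"
    using pos_bounded by blast
  note [measurable] = f(1-3) g(1-3)
  \<comment> \<open>The three terms of bop(u + du, v + dv) - bop(u, v) give this modulus. Each is at
    most K * F * G, whence the factor 3 in the envelope.\<close>
  define \<tau> where "\<tau> k x = K * (\<rho> k x * \<sigma> k x + \<rho> k x * G x + F x * \<sigma> k x)" for k x
  show ?thesis
  proof (rule loc_dominatedI[where F="\<lambda>x. 3 * K * (F x * G x)" and \<rho>=\<tau>])
    show "(\<lambda>x. bop (f a x) (g a x)) \<in> borel_measurable P"
      by (rule borel_measurable_continuous_Pair[OF f(1) g(1)])
        (intro continuous_on continuous_on_fst continuous_on_snd continuous_on_id)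
    show "\<tau> k \<in> borel_measurable P" for k unfolding \<tau>_def by measurable
    show "integrable P (\<lambda>x. (3 * K * (F x * G x)) ^ p)"
      using int by (subst power_mult_distrib) simp
    show "\<exists>\<delta>>0. AE x in P. \<forall>\<theta>. dist \<theta> a < \<delta> \<longrightarrow>
        norm (bop (f \<theta> x) (g \<theta> x) - bop (f a x) (g a x)) \<le> \<tau> k x" for k
    proof (rule radius_mono[OF radius_conj[OF f(4)[of k] g(4)[of k]]])
      show "AE x in P. \<forall>\<theta>. norm (f \<theta> x - f a x) \<le> \<rho> k x \<and> norm (g \<theta> x - g a x) \<le> \<sigma> k x \<longrightarrow>
          norm (bop (f \<theta> x) (g \<theta> x) - bop (f a x) (g a x)) \<le> \<tau> k x"
        using f(5) g(5)
      proof (eventually_elim, safe)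
        fix x \<theta>
        assume le: "norm (f \<theta> x - f a x) \<le> \<rho> k x" "norm (g \<theta> x - g a x) \<le> \<sigma> k x"
          and fa: "norm (f a x) \<le> F x" "\<forall>k. 0 \<le> \<rho> k x \<and> \<rho> k x \<le> F x"
          and ga: "norm (g a x) \<le> G x" "\<forall>k. 0 \<le> \<sigma> k x \<and> \<sigma> k x \<le> G x"
        have "0 \<le> F x" using fa(1) norm_ge_zero order_trans by blast
        have "bop (f \<theta> x) (g \<theta> x) - bop (f a x) (g a x)
            = bop (f \<theta> x - f a x) (g \<theta> x - g a x) + bop (f \<theta> x - f a x) (g a x)
              + bop (f a x) (g \<theta> x - g a x)"
          by (simp add: diff_left diff_right)
        also have "norm \<dots> \<le> norm (f \<theta> x - f a x) * norm (g \<theta> x - g a x) * K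
            + norm (f \<theta> x - f a x) * norm (g a x) * K + norm (f a x) * norm (g \<theta> x - g a x) * K"
          by (intro norm_triangle_mono K)
        also have "\<dots> \<le> \<rho> k x * \<sigma> k x * K + \<rho> k x * G x * K + F x * \<sigma> k x * K"
          using le fa ga K(1) \<open>0 \<le> F x\<close>
          by (intro add_mono mult_right_mono mult_mono) (simp_all add: order_trans[OF norm_ge_zero])
        finally show "norm (bop (f \<theta> x) (g \<theta> x) - bop (f a x) (g a x)) \<le> \<tau> k x"
          unfolding \<tau>_def by (simp add: algebra_simps)
      qed
    qed
    show "AE x in P. norm (bop (f a x) (g a x)) \<le> 3 * K * (F x * G x) \<and>
       (\<forall>k. 0 \<le> \<tau> k x \<and> \<tau> k x \<le> 3 * K * (F x * G x)) \<and> (\<lambda>k. \<tau> k x) \<longlonglongrightarrow> 0"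
      using f(5) g(5)
    proof eventually_elim
      case (elim x)
      then have nn: "0 \<le> F x" "0 \<le> G x" using norm_ge_zero order_trans by blast+
      have "norm (bop (f a x) (g a x)) \<le> F x * G x * K"
        using elim K(1) nn by (intro order_trans[OF K(2)] mult_right_mono mult_mono) simp_all
      also have "\<dots> \<le> 3 * K * (F x * G x)"
        using nn K(1) by (simp add: mult_ac)
      finally have 1: "norm (bop (f a x) (g a x)) \<le> 3 * K * (F x * G x)" .
      have 2: "0 \<le> \<tau> k x \<and> \<tau> k x \<le> 3 * K * (F x * G x)" for k
      proof
        show "0 \<le> \<tau> k x" unfolding \<tau>_def using elim nn K(1) by simp
        have "\<tau> k x \<le> K * (F x * G x + F x * G x + F x * G x)"
          unfolding \<tau>_def using elim nn K(1) by (intro mult_left_mono add_mono mult_mono) simp_all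
        then show "\<tau> k x \<le> 3 * K * (F x * G x)" by (simp add: algebra_simps)
      qed
      have "(\<lambda>k. \<tau> k x) \<longlonglongrightarrow> K * (0 * 0 + 0 * G x + F x * 0)"
        unfolding \<tau>_def using elim by (intro tendsto_intros) auto
      then show ?case using 1 2 by simp
    qed
  qed simp_all
qed

text \<open>Square integrability is consumed here: |F G| <= F^2 + G^2 makes the product envelope
  integrable, so the exponent drops from 2 to 1.\<close>

lemma loc_dominated_bilinear:
  assumes "bounded_bilinear bop" "loc_dominated P 2 a f" "loc_dominated P 2 a g"
  shows "loc_dominated P 1 a (\<lambda>\<theta> x. bop (f \<theta> x) (g \<theta> x))"
proof -
  from assms(2) obtain F \<rho> where f: "f a \<in> borel_measurable P" "F \<in> borel_measurable P"
    "integrable P (\<lambda>x. F x ^ 2)" "\<And>k. \<rho> k \<in> borel_measurable P"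
    "\<And>k::nat. \<exists>\<delta>>0. AE x in P. \<forall>\<theta>. dist \<theta> a < \<delta> \<longrightarrow> norm (f \<theta> x - f a x) \<le> \<rho> k x"
    "AE x in P. norm (f a x) \<le> F x \<and> (\<forall>k. 0 \<le> \<rho> k x \<and> \<rho> k x \<le> F x) \<and> (\<lambda>k. \<rho> k x) \<longlonglongrightarrow> 0"
    by (rule loc_dominatedE) blast
  from assms(3) obtain G \<sigma> where g: "g a \<in> borel_measurable P" "G \<in> borel_measurable P"
    "integrable P (\<lambda>x. G x ^ 2)" "\<And>k. \<sigma> k \<in> borel_measurable P"
    "\<And>k::nat. \<exists>\<delta>>0. AE x in P. \<forall>\<theta>. dist \<theta> a < \<delta> \<longrightarrow> norm (g \<theta> x - g a x) \<le> \<sigma> k x"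
    "AE x in P. norm (g a x) \<le> G x \<and> (\<forall>k. 0 \<le> \<sigma> k x \<and> \<sigma> k x \<le> G x) \<and> (\<lambda>k. \<sigma> k x) \<longlonglongrightarrow> 0"
    by (rule loc_dominatedE) blast
  have "integrable P (\<lambda>x. F x * G x)"
  proof (rule Bochner_Integration.integrable_bound)
    show "integrable P (\<lambda>x. F x ^ 2 + G x ^ 2)" using f(3) g(3) by simp
    show "(\<lambda>x. F x * G x) \<in> borel_measurable P" using f(2) g(2) by simp
    have "\<bar>F x * G x\<bar> \<le> (F x)\<^sup>2 + (G x)\<^sup>2" for x
      proof -
      have "0 \<le> \<bar>F x\<bar> * \<bar>G x\<bar>" by simp
      with sum_squares_bound[of "\<bar>F x\<bar>" "\<bar>G x\<bar>"] show ?thesis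
        unfolding abs_mult power2_abs by linarith
    qed
    then show "AE x in P. norm (F x * G x) \<le> norm ((F x)\<^sup>2 + (G x)\<^sup>2)" by simp
  qed
  then show ?thesis
    by (intro loc_dominated_bilinear_envelope[OF assms(1) f(1,2,4-6) g(1,2,4-6)]) simp
qed

text \<open>A factor depending on the parameter alone costs no moments, so the exponent p survives.
  The inverse Hessian and the mean Jacobian can therefore multiply a family that still has to enter
  \<open>outer\<close>.\<close>

lemma loc_dominated_bilinear_param:
  fixes bop :: "'b::euclidean_space \<Rightarrow> 'c::euclidean_space \<Rightarrow> 'e::euclidean_space"
  assumes "bounded_bilinear bop" "isCont h a" "loc_dominated P p a g"
  shows "loc_dominated P p a (\<lambda>\<theta> x. bop (h \<theta>) (g \<theta> x))"
proof -
  from assms(3) obtain G \<sigma> where g: "g a \<in> borel_measurable P" "G \<in> borel_measurable P"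
    "integrable P (\<lambda>x. G x ^ p)" "\<And>k. \<sigma> k \<in> borel_measurable P"
    "\<And>k::nat. \<exists>\<delta>>0. AE x in P. \<forall>\<theta>. dist \<theta> a < \<delta> \<longrightarrow> norm (g \<theta> x - g a x) \<le> \<sigma> k x"
    "AE x in P. norm (g a x) \<le> G x \<and> (\<forall>k. 0 \<le> \<sigma> k x \<and> \<sigma> k x \<le> G x) \<and> (\<lambda>k. \<sigma> k x) \<longlonglongrightarrow> 0"
    by (rule loc_dominatedE) blast
  show ?thesis
  \<comment> \<open>Continuity of h at a supplies radii for the constant moduli 1/(k+1). The largest
    of them is 1, whence the envelope \<open>norm (h a) + 1\<close>.\<close>
  proof (rule loc_dominated_bilinear_envelope[where f="\<lambda>\<theta> _. h \<theta>" and g=g and G=G and \<sigma>=\<sigma>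
        and F="\<lambda>_. norm (h a) + 1" and \<rho>="\<lambda>k _. 1 / real (Suc k)", OF assms(1) _ _ _ _ _ g(1,2,4-6)])
    show "\<exists>\<delta>>0. AE x in P. \<forall>\<theta>. dist \<theta> a < \<delta> \<longrightarrow> norm (h \<theta> - h a) \<le> 1 / real (Suc k)" for k
    proof -
      have "0 < 1 / real (Suc k)" by simp
      then obtain d where "0 < d" "\<And>\<theta>. dist \<theta> a < d \<Longrightarrow> dist (h \<theta>) (h a) < 1 / real (Suc k)"
        using assms(2) unfolding continuous_at_eps_delta by blast
      then show ?thesis by (intro exI[of _ d]) (auto simp: dist_norm less_imp_le)
    qed
    have "1 / real (Suc k) \<le> norm (h a) + 1" for k
      by (rule order_trans[of _ 1]) auto
    then show "AE x in P. norm (h a) \<le> norm (h a) + 1 \<and>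
        (\<forall>k. 0 \<le> 1 / real (Suc k) \<and> 1 / real (Suc k) \<le> norm (h a) + 1) \<and>
        (\<lambda>k. 1 / real (Suc k)) \<longlonglongrightarrow> 0"
      using LIMSEQ_inverse_real_of_nat by (simp add: inverse_eq_divide)
    show "integrable P (\<lambda>x. ((norm (h a) + 1) * G x) ^ p)"
      using g(3) by (subst power_mult_distrib) simp
  qed auto
qed

text \<open>X n depends on the same sample, so the weak law cannot be applied to f (X n) directly.
  Once X n is within the radius around a, however, replacing it by a changes the empirical mean by
  at most that of the fixed function \<rho> k, whose expectation is small by dominated
  convergence.\<close>

lemma (in iid) uniform_weak_law:
  fixes f :: "'a::metric_space \<Rightarrow> 'x \<Rightarrow> 'b::euclidean_space"
  assumes "loc_dominated P 1 a f" and conv: "conv_prob S X a"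
  shows "conv_prob S (\<lambda>n \<omega>. emp \<xi> n \<omega> (f (X n \<omega>))) (\<integral>x. f a x \<partial>P)"
  unfolding conv_prob_def
proof (intro allI impI)
  fix \<epsilon> :: real assume "0 < \<epsilon>"
  from assms(1) obtain F \<rho> where *: "f a \<in> borel_measurable P" "F \<in> borel_measurable P"
    "integrable P (\<lambda>x. F x ^ 1)" "\<And>k. \<rho> k \<in> borel_measurable P"
    "\<And>k::nat. \<exists>\<delta>>0. AE x in P. \<forall>\<theta>. dist \<theta> a < \<delta> \<longrightarrow> norm (f \<theta> x - f a x) \<le> \<rho> k x"
    "AE x in P. norm (f a x) \<le> F x \<and> (\<forall>k. 0 \<le> \<rho> k x \<and> \<rho> k x \<le> F x) \<and> (\<lambda>k. \<rho> k x) \<longlonglongrightarrow> 0"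
    by (rule loc_dominatedE) blast
  have F: "integrable P F" using *(3) by simp
  have le: "AE x in P. norm (\<rho> k x) \<le> F x" for k
    using *(6) by eventually_elim simp
  have "(\<lambda>k. \<integral>x. \<rho> k x \<partial>P) \<longlonglongrightarrow> (\<integral>x. 0 \<partial>P)"
    by (rule integral_dominated_convergence[OF _ *(4) F _ le]) (use *(6) in auto)
  then have "\<forall>\<^sub>F k in sequentially. (\<integral>x. \<rho> k x \<partial>P) < \<epsilon> / 3"
    using \<open>0 < \<epsilon>\<close> by (intro order_tendstoD(2)) auto
  then obtain k where k: "(\<integral>x. \<rho> k x \<partial>P) < \<epsilon> / 3" by (auto simp: eventually_sequentially)
  have int: "integrable P (\<rho> k)"
  proof (rule Bochner_Integration.integrable_bound[OF F *(4)])
    show "AE x in P. norm (\<rho> k x) \<le> norm (F x)"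
      using le[of k] by eventually_elim simp
  qed
  obtain d where "0 < d" and d: "AE x in P. \<forall>\<theta>. dist \<theta> a < d \<longrightarrow> norm (f \<theta> x - f a x) \<le> \<rho> k x"
    using *(5)[of k] by blast
  \<comment> \<open>The three shares of \<epsilon>/3 go to the expectation of \<rho> k, to the
    deviation of its empirical mean, and to the deviation of the empirical mean of f a.\<close>
  have "0 < \<epsilon> / 3" using \<open>0 < \<epsilon>\<close> by simp
  from whp_conj[OF whp_conj[OF whp_sample[OF d] conv_probD[OF conv \<open>0 < d\<close>]]
      whp_conj[OF conv_probD[OF weak_law[OF int] this]
        conv_probD[OF weak_law[OF loc_dominated_integrable[OF assms(1)]] this]]]
  show "whp S (\<lambda>n \<omega>. dist (emp \<xi> n \<omega> (f (X n \<omega>))) (\<integral>x. f a x \<partial>P) < \<epsilon>)"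
  proof (rule whp_mono, elim conjE)
    fix n \<omega>
    assume 1: "\<forall>i \<theta>. dist \<theta> a < d \<longrightarrow> norm (f \<theta> (\<xi> i \<omega>) - f a (\<xi> i \<omega>)) \<le> \<rho> k (\<xi> i \<omega>)"
      and 2: "dist (X n \<omega>) a < d" and 3: "dist (emp \<xi> n \<omega> (\<rho> k)) (integral\<^sup>L P (\<rho> k)) < \<epsilon> / 3"
      and 4: "dist (emp \<xi> n \<omega> (f a)) (integral\<^sup>L P (f a)) < \<epsilon> / 3"
    have "norm (emp \<xi> n \<omega> (\<lambda>x. f (X n \<omega>) x - f a x)) \<le> emp \<xi> n \<omega> (\<rho> k)"
      using 1 2 by (intro norm_emp_le) auto
    also have "\<dots> < \<epsilon> / 3 + \<epsilon> / 3" using 3 k unfolding dist_real_def by linarith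
    finally have "dist (emp \<xi> n \<omega> (f (X n \<omega>))) (emp \<xi> n \<omega> (f a)) < \<epsilon> / 3 + \<epsilon> / 3"
      by (simp add: emp_diff dist_norm)
    with 4 dist_triangle[of "emp \<xi> n \<omega> (f (X n \<omega>))" "\<integral>x. f a x \<partial>P" "emp \<xi> n \<omega> (f a)"]
    show "dist (emp \<xi> n \<omega> (f (X n \<omega>))) (\<integral>x. f a x \<partial>P) < \<epsilon>" by linarith
  qed
qed

section \<open>Matrices\<close>

lemma bounded_bilinear_matrix_vector_mult:
  "bounded_bilinear ((*v) :: real^'n^'m \<Rightarrow> real^'n \<Rightarrow> real^'m)"
proof -
  have "bilinear ((*v) :: real^'n^'m \<Rightarrow> real^'n \<Rightarrow> real^'m)"
    unfolding bilinear_def linear_iff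
    by (auto simp: matrix_vector_mult_add_rdistrib matrix_vector_right_distrib
      scaleR_matrix_vector_assoc matrix_vector_mult_scaleR)
  then show ?thesis by (simp add: bilinear_conv_bounded_bilinear)
qed

lemma bounded_bilinear_matrix_matrix_mult:
  "bounded_bilinear ((**) :: real^'n^'m \<Rightarrow> real^'k^'n \<Rightarrow> real^'k^'m)"
proof -
  have "bilinear ((**) :: real^'n^'m \<Rightarrow> real^'k^'n \<Rightarrow> real^'k^'m)"
    unfolding bilinear_def linear_iff
    by (auto simp: matrix_matrix_mult_def vec_eq_iff sum_distrib_left sum.distrib ring_distribs mult_ac)
  then show ?thesis by (simp add: bilinear_conv_bounded_bilinear)
qed

lemma bounded_bilinear_outer:
  "bounded_bilinear (outer :: real^'m \<Rightarrow> real^'n \<Rightarrow> real^'n^'m)"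
proof -
  have "bilinear (outer :: real^'m \<Rightarrow> real^'n \<Rightarrow> real^'n^'m)"
    unfolding bilinear_def linear_iff
    by (auto simp: outer_def vec_eq_iff algebra_simps)
  then show ?thesis by (simp add: bilinear_conv_bounded_bilinear)
qed

lemma op_norm_nonneg: "0 \<le> op_norm A"
  unfolding op_norm_def by (rule onorm_pos_le) simp

lemma op_norm_le_norm:
  fixes A :: "real^'n^'m"
  shows "op_norm A \<le> real CARD('m) * real CARD('n) * norm A"
  unfolding op_norm_def
proof (rule onorm_le_matrix_component)
  fix i j
  have "\<bar>A $ i $ j\<bar> \<le> norm (A $ i)" by (rule component_le_norm_cart)
  also have "\<dots> \<le> norm A" by (rule Finite_Cartesian_Product.norm_nth_le)
  finally show "\<bar>A $ i $ j\<bar> \<le> norm A" .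
qed

lemma norm_le_op_norm:
  fixes A :: "real^'n^'m"
  shows "norm A \<le> real CARD('m) * real CARD('n) * op_norm A"
proof -
  have "norm A \<le> (\<Sum>i\<in>UNIV. norm (A $ i))"
    unfolding norm_vec_def by (rule L2_set_le_sum) simp
  also have "\<dots> \<le> (\<Sum>i\<in>(UNIV :: 'm set). \<Sum>j\<in>(UNIV :: 'n set). op_norm A)"
  proof (rule sum_mono)
    fix i
    have "norm (A $ i) \<le> (\<Sum>j\<in>UNIV. \<bar>A $ i $ j\<bar>)" by (rule norm_le_l1_cart)
    also have "\<dots> \<le> (\<Sum>j\<in>(UNIV :: 'n set). op_norm A)"
      unfolding op_norm_def by (intro sum_mono matrix_component_le_onorm)
    finally show "norm (A $ i) \<le> (\<Sum>j\<in>(UNIV :: 'n set). op_norm A)" .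
  qed
  finally show ?thesis by (simp add: mult.assoc)
qed

text \<open>The main claim is in the operator norm, whereas \<open>conv_prob\<close> uses the
  Euclidean norm of the entries. Comparing both with single entries gives the same constant C in
  both directions.\<close>

lemma conv_prob_iff_op_norm:
  fixes X :: "nat \<Rightarrow> 'w \<Rightarrow> real^'n^'m"
  shows "conv_prob S X A \<longleftrightarrow> small_op S (\<lambda>n \<omega>. op_norm (X n \<omega> - A))"
proof -
  define C where "C = real CARD('m) * real CARD('n)"
  have C: "0 < C" by (simp add: C_def)
  have small: "small_op S V" if "small_op S W" "\<And>n \<omega>. \<bar>V n \<omega>\<bar> \<le> C * \<bar>W n \<omega>\<bar>"
    for V W :: "nat \<Rightarrow> 'w \<Rightarrow> real"
    unfolding small_op_iff_whp
  proof (intro allI impI)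
    fix \<epsilon> :: real assume "0 < \<epsilon>"
    then have "whp S (\<lambda>n \<omega>. \<bar>W n \<omega>\<bar> \<le> \<epsilon> / C)" using that(1) C unfolding small_op_iff_whp by simp
    then show "whp S (\<lambda>n \<omega>. \<bar>V n \<omega>\<bar> \<le> \<epsilon>)"
    proof (rule whp_mono)
      fix n \<omega> assume "\<bar>W n \<omega>\<bar> \<le> \<epsilon> / C"
      then have "C * \<bar>W n \<omega>\<bar> \<le> \<epsilon>" using C by (simp add: field_simps)
      then show "\<bar>V n \<omega>\<bar> \<le> \<epsilon>" using that(2) order_trans by blast
    qed
  qed
  show ?thesis
    unfolding conv_prob_iff_small_op dist_norm
    using op_norm_le_norm norm_le_op_norm
    by (intro iffI; elim small) (auto simp: C_def op_norm_nonneg)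
qed

section \<open>The pseudoinverse near an invertible matrix\<close>

lemma pinv_eqI:
  fixes A B :: "real^'n^'n"
  assumes "A ** B = mat 1"
  shows "pinv A = B"
  unfolding pinv_def
proof (rule the_equality)
  have BA: "B ** A = mat 1" using assms by (simp add: matrix_left_right_inverse)
  show "A ** B ** A = A \<and> B ** A ** B = B \<and>
      transpose (A ** B) = A ** B \<and> transpose (B ** A) = B ** A"
    using assms BA by simp
  fix C assume "A ** C ** A = A \<and> C ** A ** C = C \<and>
      transpose (A ** C) = A ** C \<and> transpose (C ** A) = C ** A"
  \<comment> \<open>Multiplying the first Penrose equation by B on both sides cancels A and leaves C
    = B.\<close>
  then have "B ** (A ** C ** A) ** B = B ** A ** B" by simp
  then have "(B ** A) ** C ** (A ** B) = (B ** A) ** B" by (simp only: matrix_mul_assoc)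
  then show "C = B" using assms BA by simp
qed

text \<open>The influence function is written with \<open>matrix_inv\<close>, a choice operator, and
  its estimator with \<open>pinv\<close>; at the limit both must be the same matrix.\<close>

lemma matrix_inv_eq_pinv:
  fixes A :: "real^'n^'n"
  assumes "invertible A"
  shows "matrix_inv A = pinv A"
proof -
  have "A ** matrix_inv A = mat 1 \<and> matrix_inv A ** A = mat 1"
    using assms unfolding invertible_def matrix_inv_def by (rule someI_ex)
  then show ?thesis using pinv_eqI by metis
qed

lemma tendsto_det [tendsto_intros]:
  fixes f :: "'a \<Rightarrow> real^'n^'n"
  assumes "(f \<longlongrightarrow> A) F"
  shows "((\<lambda>x. det (f x)) \<longlongrightarrow> det A) F"
  unfolding det_def by (intro tendsto_intros assms)

text \<open>The adjugate divided by the determinant: column l solves A x = e_l by Cramer's rule. Its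
  entries are rational in those of A, which makes continuity visible.\<close>

definition cramer_inverse :: "real^'n^'n \<Rightarrow> real^'n^'n" where
  "cramer_inverse A = (\<chi> k l. det (\<chi> i j. if j = k then axis l 1 $ i else A $ i $ j) / det A)"

lemma pinv_eq_cramer_inverse:
  fixes A :: "real^'n^'n"
  assumes "det A \<noteq> 0"
  shows "pinv A = cramer_inverse A"
proof (rule pinv_eqI)
  have "A *v column l (cramer_inverse A) = axis l 1" for l
    by (subst cramer[OF assms]) (simp add: column_def cramer_inverse_def)
  then have "(A ** cramer_inverse A) $ i $ l = axis l 1 $ i" for i l
    by (simp add: matrix_matrix_mult_def matrix_vector_mult_def column_def vec_eq_iff)
  then show "A ** cramer_inverse A = mat 1"
    by (simp add: vec_eq_iff mat_def axis_def)
qed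

text \<open>Near an invertible matrix the determinant stays nonzero, so \<open>pinv\<close>
  coincides with Cramer's formula on a whole neighbourhood.\<close>

lemma isCont_pinv:
  fixes A :: "real^'n^'n"
  assumes "invertible A"
  shows "isCont pinv A"
proof -
  have det: "det A \<noteq> 0" using assms by (simp add: invertible_det_nz)
  have "((\<lambda>X. det X) \<longlongrightarrow> det A) (nhds A)" by (intro tendsto_det filterlim_ident)
  then have ev: "\<forall>\<^sub>F X in nhds A. det X \<noteq> 0" using det by (rule tendsto_imp_eventually_ne)
  have "(cramer_inverse \<longlongrightarrow> cramer_inverse A) (nhds A)"
    unfolding cramer_inverse_def[abs_def]
  proof (intro tendsto_intros det filterlim_ident)
    fix k l i j :: 'n
    show "((\<lambda>X. if j = k then axis l 1 $ i else X $ i $ j) \<longlongrightarrow>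
        (if j = k then axis l 1 $ i else A $ i $ j)) (nhds A)"
      by (cases "j = k") (auto intro!: tendsto_intros filterlim_ident)
  qed
  then have "(pinv \<longlongrightarrow> cramer_inverse A) (nhds A)"
    by (rule Lim_transform_eventually) (use ev in \<open>auto elim!: eventually_mono simp: pinv_eq_cramer_inverse\<close>)
  then have "(pinv \<longlongrightarrow> pinv A) (nhds A)" by (simp add: pinv_eq_cramer_inverse[OF det])
  then show ?thesis
    unfolding isCont_def by (rule filterlim_mono) (simp_all add: at_within_le_nhds)
qed

lemma invertible_if_positive:
  fixes A :: "real^'n^'n"
  assumes "\<And>v. v \<noteq> 0 \<Longrightarrow> 0 < v \<bullet> (A *v v)"
  shows "invertible A"
proof -
  have "\<forall>v. A *v v = 0 \<longrightarrow> v = 0" using assms by (metis inner_zero_right less_irrefl)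
  then show ?thesis
    by (simp add: invertible_left_inverse matrix_left_invertible_ker)
qed

lemma inner_outer_mult: "v \<bullet> (outer x x *v v) = (v \<bullet> x)\<^sup>2"
proof -
  have "outer x x *v v = (x \<bullet> v) *\<^sub>R x"
    by (simp add: vec_eq_iff outer_def matrix_vector_mult_def inner_vec_def sum_distrib_left
      sum_distrib_right mult_ac)
  then show ?thesis by (simp add: power2_eq_square inner_commute)
qed

text \<open>The second moment is the covariance plus the rank-one matrix of the mean.\<close>

lemma invertible_second_moment:
  fixes X :: "'x \<Rightarrow> real^'n"
  assumes "prob_space P" and X: "integrable P X" and XX: "integrable P (\<lambda>x. outer (X x) (X x))"
    and pd: "pos_def (covar P X X)"
  shows "invertible (\<integral>x. outer (X x) (X x) \<partial>P)"
proof -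
  interpret prob_space P by fact
  interpret outer: bounded_bilinear "outer :: real^'n \<Rightarrow> real^'n \<Rightarrow> real^'n^'n"
    by (rule bounded_bilinear_outer)
  define m where "m = (\<integral>x. X x \<partial>P)"
  have 1: "integrable P (\<lambda>x. outer (X x) m)" "(\<integral>x. outer (X x) m \<partial>P) = outer m m"
    using integrable_bounded_linear[OF outer.bounded_linear_left X]
      integral_bounded_linear[OF outer.bounded_linear_left X] by (auto simp: m_def)
  have 2: "integrable P (\<lambda>x. outer m (X x))" "(\<integral>x. outer m (X x) \<partial>P) = outer m m"
    using integrable_bounded_linear[OF outer.bounded_linear_right X]
      integral_bounded_linear[OF outer.bounded_linear_right X] by (auto simp: m_def)
  have "covar P X X = (\<integral>x. outer (X x) (X x) - outer (X x) m - outer m (X x) + outer m m \<partial>P)"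
    unfolding covar_def m_def[symmetric]
    by (simp add: outer.diff_left outer.diff_right algebra_simps)
  also have "\<dots> = (\<integral>x. outer (X x) (X x) \<partial>P) - outer m m"
    using XX 1 2 by (simp add: prob_space)
  finally have eq: "(\<integral>x. outer (X x) (X x) \<partial>P) = covar P X X + outer m m" by simp
  show ?thesis
  proof (rule invertible_if_positive)
    fix v :: "real^'n" assume "v \<noteq> 0"
    then have "0 < v \<bullet> (covar P X X *v v)" using pd unfolding pos_def_def by blast
    then show "0 < v \<bullet> ((\<integral>x. outer (X x) (X x) \<partial>P) *v v)"
      unfolding eq by (simp add: matrix_vector_mult_add_rdistrib inner_add_right inner_outer_mult
        add_pos_nonneg)
  qed
qed

section \<open>Subgradients and derivatives as locally dominated families\<close>

text \<open>The Limsup only sees points y and y + t v close to \<theta>, both eventually in U, so a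
  one-sided bound on increments passes to g. The bound has a linear part and a relative error to
  serve two purposes: with D the strict derivative and c small it identifies g, with D an inner
  product it yields \<open>clarke_subdifferential_norm_diff_le\<close>.\<close>

lemma clarke_subdifferential_le:
  assumes g: "g \<in> clarke_subdifferential f \<theta>" and U: "open U" "\<theta> \<in> U" and D: "bounded_linear D"
    and le: "\<And>y z. y \<in> U \<Longrightarrow> z \<in> U \<Longrightarrow> f y - f z \<le> D (y - z) + c * norm (y - z)"
  shows "g \<bullet> v \<le> D v + c * norm v"
proof -
  interpret D: bounded_linear D by fact
  define \<F> where "\<F> = (nhds \<theta> \<times>\<^sub>F at_right (0::real))"
  have fst: "(fst \<longlongrightarrow> \<theta>) \<F>"
    unfolding \<F>_def by (rule filterlim_fst)
  have snd: "filterlim snd (at_right 0) \<F>"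
    unfolding \<F>_def by (rule filterlim_snd)
  then have snd0: "(snd \<longlongrightarrow> 0) \<F>"
    by (rule filterlim_mono) (simp_all add: at_within_le_nhds)
  have "((\<lambda>p. fst p + snd p *\<^sub>R v) \<longlongrightarrow> \<theta> + 0 *\<^sub>R v) \<F>"
    by (intro tendsto_add tendsto_scaleR tendsto_const fst snd0)
  then have "\<forall>\<^sub>F p in \<F>. fst p + snd p *\<^sub>R v \<in> U"
    by (rule topological_tendstoD) (use U in simp_all)
  moreover have "\<forall>\<^sub>F p in \<F>. fst p \<in> U"
    using fst U by (rule topological_tendstoD)
  moreover have "\<forall>\<^sub>F p in \<F>. 0 < snd p"
    using eventually_at_right_less[of "0::real"] snd by (rule eventually_compose_filterlim)
  ultimately have "\<forall>\<^sub>F p in \<F>. (\<lambda>(y, t). ereal ((f (y + t *\<^sub>R v) - f y) / t)) p \<le> ereal (D v + c * norm v)"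
  proof eventually_elim
    case (elim p)
    have "f (fst p + snd p *\<^sub>R v) - f (fst p) \<le> D (snd p *\<^sub>R v) + c * norm (snd p *\<^sub>R v)"
      using le[OF elim(1,2)] by simp
    also have "\<dots> = (D v + c * norm v) * snd p"
      using elim(3) by (simp add: D.scaleR ring_distribs mult_ac)
    finally show ?case using elim(3) by (simp add: case_prod_beta pos_divide_le_eq)
  qed
  then have "Limsup \<F> (\<lambda>(y, t). ereal ((f (y + t *\<^sub>R v) - f y) / t)) \<le> ereal (D v + c * norm v)"
    by (rule Limsup_bounded)
  moreover have "ereal (g \<bullet> v) \<le> Limsup \<F> (\<lambda>(y, t). ereal ((f (y + t *\<^sub>R v) - f y) / t))"
    using g unfolding clarke_subdifferential_def \<F>_def by blast
  ultimately have "ereal (g \<bullet> v) \<le> ereal (D v + c * norm v)" by (rule order_trans[rotated])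
  then show ?thesis by simp
qed

text \<open>Testing in the direction v = g - d gives |g - d|^2 <= c |g - d|. With d = 0 this bounds
  subgradients by the Lipschitz constant; with d = \<open>dl \<theta>s x\<close> it controls how far
  a nearby subgradient strays.\<close>

lemma clarke_subdifferential_norm_diff_le:
  assumes "g \<in> clarke_subdifferential f \<theta>" "open U" "\<theta> \<in> U" "0 \<le> c"
    and "\<And>y z. y \<in> U \<Longrightarrow> z \<in> U \<Longrightarrow> f y - f z \<le> d \<bullet> (y - z) + c * norm (y - z)"
  shows "norm (g - d) \<le> c"
proof (cases "g = d")
  case False
  have "(g - d) \<bullet> (g - d) \<le> c * norm (g - d)"
    using clarke_subdifferential_le[OF assms(1-3) bounded_linear_inner_right assms(5), of "g - d"]
    by (simp add: inner_diff_left)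
  then have "norm (g - d) * norm (g - d) \<le> c * norm (g - d)"
    by (simp add: power2_norm_eq_inner[symmetric] power2_eq_square)
  then show ?thesis using False by (simp add: mult_le_cancel_right)
qed (simp add: assms(4))

text \<open>Strict differentiability leaves a single Clarke subgradient: the inner product of g with
  v is at most D v, for v as well as for -v, so g represents D. The anonymous derivative in the
  definition can thus be replaced by the selected \<open>dl\<close>.\<close>

lemma strictly_differentiable_clarke_gradient:
  assumes sd: "strictly_differentiable_at f \<theta>" and g: "g \<in> clarke_subdifferential f \<theta>" and "0 < \<epsilon>"
  obtains \<delta> where "0 < \<delta>"
    "\<And>y z. y \<in> ball \<theta> \<delta> \<Longrightarrow> z \<in> ball \<theta> \<delta> \<Longrightarrow> \<bar>f y - f z - g \<bullet> (y - z)\<bar> \<le> \<epsilon> * norm (y - z)"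
proof -
  obtain D where D: "bounded_linear D"
    and lim: "((\<lambda>(y, z). (f y - f z - D (y - z)) / norm (y - z)) \<longlongrightarrow> 0) (nhds \<theta> \<times>\<^sub>F nhds \<theta>)"
    using sd unfolding strictly_differentiable_at_def by blast
  interpret D: bounded_linear D by fact
  have ex: "\<exists>\<delta>>0. \<forall>y\<in>ball \<theta> \<delta>. \<forall>z\<in>ball \<theta> \<delta>. \<bar>f y - f z - D (y - z)\<bar> \<le> e * norm (y - z)" if "0 < e" for e
  proof -
    have "\<forall>\<^sub>F p in nhds \<theta> \<times>\<^sub>F nhds \<theta>. dist ((\<lambda>(y, z). (f y - f z - D (y - z)) / norm (y - z)) p) 0 < e"
      using lim \<open>0 < e\<close> by (rule tendstoD)
    then obtain Q where Q: "eventually Q (nhds \<theta>)"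
      "\<And>y z. Q y \<Longrightarrow> Q z \<Longrightarrow> \<bar>(f y - f z - D (y - z)) / norm (y - z)\<bar> < e"
      unfolding eventually_prod_same by auto
    obtain \<delta> where \<delta>: "0 < \<delta>" "\<And>y. dist y \<theta> < \<delta> \<Longrightarrow> Q y"
      using Q(1) unfolding eventually_nhds_metric by blast
    have "\<bar>f y - f z - D (y - z)\<bar> \<le> e * norm (y - z)" if "y \<in> ball \<theta> \<delta>" "z \<in> ball \<theta> \<delta>" for y z
    proof (cases "y = z")
      case False
      then show ?thesis
        using Q(2)[of y z] \<delta>(2) that by (simp add: dist_commute abs_divide pos_divide_less_eq)
    qed (simp add: D.zero)
    then show ?thesis using \<delta>(1) by blast
  qed
  have le: "g \<bullet> v \<le> D v" for v
  proof (cases "v = 0")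
    case False
    show ?thesis
    proof (rule field_le_epsilon)
      fix e :: real assume "0 < e"
      \<comment> \<open>Dividing by \<open>norm v\<close> in advance turns the relative error into
        the absolute error e.\<close>
      then have "0 < e / norm v" using False by simp
      from ex[OF this] obtain \<delta> where \<delta>: "0 < \<delta>"
        "\<forall>y\<in>ball \<theta> \<delta>. \<forall>z\<in>ball \<theta> \<delta>. \<bar>f y - f z - D (y - z)\<bar> \<le> e / norm v * norm (y - z)" by blast
      have "g \<bullet> v \<le> D v + e / norm v * norm v"
      proof (rule clarke_subdifferential_le[OF g open_ball _ D])
        show "\<theta> \<in> ball \<theta> \<delta>" using \<delta>(1) by simp
        fix y z assume "y \<in> ball \<theta> \<delta>" "z \<in> ball \<theta> \<delta>"
        then have "\<bar>f y - f z - D (y - z)\<bar> \<le> e / norm v * norm (y - z)" using \<delta>(2) by blast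
        then show "f y - f z \<le> D (y - z) + e / norm v * norm (y - z)" by linarith
      qed
      then show "g \<bullet> v \<le> D v + e" using False by simp
    qed
  qed (simp add: D.zero)
  have "D v = g \<bullet> v" for v
    using le[of v] le[of "- v"] by (simp add: D.neg)
  then show thesis using ex[OF \<open>0 < \<epsilon>\<close>] that by auto
qed

text \<open>For almost every x, the modulus \<rho> k is the least upper bound of the quotients h
  over pairs of distinct points of B k. It is built from \<open>l\<close> and
  \<open>dl \<theta>s\<close> alone; subgradients at the other points of B k are compared with
  \<open>dl \<theta>s\<close> through \<open>clarke_subdifferential_norm_diff_le\<close>.\<close>

lemma loc_dominated_subgradient:
  fixes l :: "'a::euclidean_space \<Rightarrow> 'x \<Rightarrow> real"
  assumes U: "open U" "\<theta>s \<in> U" and l: "\<And>\<theta>. \<theta> \<in> U \<Longrightarrow> l \<theta> \<in> borel_measurable P"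
    and L: "L \<in> borel_measurable P" "integrable P (\<lambda>x. L x ^ p)"
    and lip: "AE x in P. \<forall>\<theta>1\<in>U. \<forall>\<theta>2\<in>U. \<bar>l \<theta>1 x - l \<theta>2 x\<bar> \<le> L x * norm (\<theta>1 - \<theta>2)"
    and dl: "dl \<theta>s \<in> borel_measurable P"
    and sub: "AE x in P. \<forall>\<theta>\<in>U. dl \<theta> x \<in> clarke_subdifferential (\<lambda>\<theta>. l \<theta> x) \<theta>"
    and sd: "AE x in P. strictly_differentiable_at (\<lambda>\<theta>. l \<theta> x) \<theta>s"
  shows "loc_dominated P p \<theta>s dl"
proof -
  obtain r where r: "0 < r" "ball \<theta>s r \<subseteq> U"
    using U by (auto simp: open_contains_ball)
  define B where "B k = ball \<theta>s (r / real (Suc k))" for k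
  have B: "open (B k)" "\<theta>s \<in> B k" "B k \<subseteq> U" for k
  proof -
    have "r / real (Suc k) \<le> r" using r(1) by (simp add: divide_le_eq)
    then show "B k \<subseteq> U" unfolding B_def using r(2) by (meson subset_ball subset_trans)
  qed (use r in \<open>simp_all add: B_def\<close>)
  \<comment> \<open>Off the diagonal the quotient h has no division by zero and is continuous. V k
    remains open, as the measurability of the supremum requires.\<close>
  define V where "V k = {p. fst p \<in> B k \<and> snd p \<in> B k \<and> fst p \<noteq> snd p}" for k
  have V: "open (V k)" for k
  proof -
    have "V k = (B k \<times> B k) \<inter> - {p. fst p = snd p}" unfolding V_def by auto
    then show ?thesis
      using B(1)[of k] by (auto intro!: open_Int open_Times closed_Collect_eq continuous_intros simp: open_Compl)
  qed
  define h where "h p x = \<bar>l (fst p) x - l (snd p) x - dl \<theta>s x \<bullet> (fst p - snd p)\<bar> / norm (fst p - snd p)" for p x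
  have h_meas: "h p \<in> borel_measurable P" if "p \<in> V k" for p k
  proof -
    have [measurable]: "l (fst p) \<in> borel_measurable P" "l (snd p) \<in> borel_measurable P"
      using that B(3)[of k] l unfolding V_def by blast+
    note dl[measurable]
    show ?thesis unfolding h_def by measurable
  qed
  have h_cont: "AE x in P. continuous_on (V k) (\<lambda>p. h p x)" for k
    using lip
  proof eventually_elim
    case (elim x)
    have "continuous_on U (\<lambda>\<theta>. l \<theta> x)"
    proof (rule lipschitz_on_continuous_on)
      show "\<bar>L x\<bar>-lipschitz_on U (\<lambda>\<theta>. l \<theta> x)"
      proof (rule lipschitz_onI)
        fix y z assume "y \<in> U" "z \<in> U"
        then have "\<bar>l y x - l z x\<bar> \<le> L x * norm (y - z)" using elim by blast
        also have "\<dots> \<le> \<bar>L x\<bar> * norm (y - z)" by (intro mult_right_mono) auto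
        finally show "dist (l y x) (l z x) \<le> \<bar>L x\<bar> * dist y z" by (simp add: dist_norm)
      qed simp
    qed
    then have "continuous_on (V k) (\<lambda>p. l (fst p) x)" "continuous_on (V k) (\<lambda>p. l (snd p) x)"
      using B(3)[of k]
      by (auto intro!: continuous_on_compose2[of U "\<lambda>\<theta>. l \<theta> x"] continuous_intros simp: V_def)
    then show ?case
      unfolding h_def by (intro continuous_intros) (auto simp: V_def)
  qed
  have dl_le: "AE x in P. norm (dl \<theta>s x) \<le> \<bar>L x\<bar>"
    using lip sub
  proof eventually_elim
    case (elim x)
    have "norm (dl \<theta>s x - 0) \<le> \<bar>L x\<bar>"
    proof (rule clarke_subdifferential_norm_diff_le[OF _ U])
      show "dl \<theta>s x \<in> clarke_subdifferential (\<lambda>\<theta>. l \<theta> x) \<theta>s" using elim U by blast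
      fix y z assume "y \<in> U" "z \<in> U"
      then have "\<bar>l y x - l z x\<bar> \<le> L x * norm (y - z)" using elim by blast
      also have "\<dots> \<le> \<bar>L x\<bar> * norm (y - z)" by (intro mult_right_mono) auto
      finally show "l y x - l z x \<le> 0 \<bullet> (y - z) + \<bar>L x\<bar> * norm (y - z)" by simp
    qed simp
    then show ?case by simp
  qed
  \<comment> \<open>One |L| bounds the increment of \<open>l\<close>, the other the linear term. The
    absolute value is there because \<open>L\<close> carries no sign hypothesis.\<close>
  have h_le: "AE x in P. \<forall>k. \<forall>p\<in>V k. h p x \<le> 2 * \<bar>L x\<bar>"
    using lip dl_le
  proof (eventually_elim, intro allI ballI)
    fix x k p
    assume lip: "\<forall>\<theta>1\<in>U. \<forall>\<theta>2\<in>U. \<bar>l \<theta>1 x - l \<theta>2 x\<bar> \<le> L x * norm (\<theta>1 - \<theta>2)"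
      and dlx: "norm (dl \<theta>s x) \<le> \<bar>L x\<bar>" and p: "p \<in> V k"
    let ?d = "fst p - snd p"
    have "fst p \<in> U" "snd p \<in> U" using p B(3)[of k] unfolding V_def by blast+
    then have "\<bar>l (fst p) x - l (snd p) x\<bar> \<le> L x * norm ?d" using lip by blast
    also have "\<dots> \<le> \<bar>L x\<bar> * norm ?d" by (intro mult_right_mono) auto
    finally have 1: "\<bar>l (fst p) x - l (snd p) x\<bar> \<le> \<bar>L x\<bar> * norm ?d" .
    have 2: "\<bar>dl \<theta>s x \<bullet> ?d\<bar> \<le> \<bar>L x\<bar> * norm ?d"
      using Cauchy_Schwarz_ineq2[of "dl \<theta>s x" ?d] mult_right_mono[OF dlx norm_ge_zero[of ?d]] by linarith
    have "\<bar>l (fst p) x - l (snd p) x - dl \<theta>s x \<bullet> ?d\<bar> \<le> 2 * \<bar>L x\<bar> * norm ?d"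
      using 1 2 by linarith
    then show "h p x \<le> 2 * \<bar>L x\<bar>"
      using p unfolding h_def V_def by (simp add: pos_divide_le_eq)
  qed
  have "\<exists>R. R \<in> borel_measurable P \<and> (\<forall>x. 0 \<le> R x) \<and>
      (AE x in P. (\<forall>p\<in>V k. h p x \<le> R x) \<and> (\<forall>b\<ge>0. (\<forall>p\<in>V k. h p x \<le> b) \<longrightarrow> R x \<le> b))" for k
  proof (rule measurable_sup_continuous_AE[where h=h and P=P, OF V[of k] h_meas h_cont])
    show "AE x in P. \<exists>b. \<forall>\<theta>\<in>V k. h \<theta> x \<le> b"
      using h_le by eventually_elim blast
  qed (assumption, rule exI, intro conjI allI, assumption+)
  then have "\<forall>k. \<exists>R. R \<in> borel_measurable P \<and> (\<forall>x. 0 \<le> R x) \<and>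
      (AE x in P. (\<forall>p\<in>V k. h p x \<le> R x) \<and> (\<forall>b\<ge>0. (\<forall>p\<in>V k. h p x \<le> b) \<longrightarrow> R x \<le> b))"
    by (rule allI)
  from choice[OF this] obtain \<rho> where "\<forall>k. \<rho> k \<in> borel_measurable P \<and> (\<forall>x. 0 \<le> \<rho> k x) \<and>
      (AE x in P. (\<forall>p\<in>V k. h p x \<le> \<rho> k x) \<and> (\<forall>b\<ge>0. (\<forall>p\<in>V k. h p x \<le> b) \<longrightarrow> \<rho> k x \<le> b))" ..
  then have \<rho>: "\<rho> k \<in> borel_measurable P" "0 \<le> \<rho> k x"
    "AE x in P. (\<forall>p\<in>V k. h p x \<le> \<rho> k x) \<and> (\<forall>b\<ge>0. (\<forall>p\<in>V k. h p x \<le> b) \<longrightarrow> \<rho> k x \<le> b)" for k x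
    by simp_all
  show ?thesis
  proof (rule loc_dominatedI[where F="\<lambda>x. 2 * \<bar>L x\<bar>" and \<rho>=\<rho>])
    show "(\<lambda>x. 2 * \<bar>L x\<bar>) \<in> borel_measurable P" using L(1) by simp
    show "integrable P (\<lambda>x. (2 * \<bar>L x\<bar>) ^ p)"
      using integrable_abs[OF L(2)] by (simp add: power_mult_distrib power_abs)
    show "\<exists>\<delta>>0. AE x in P. \<forall>\<theta>. dist \<theta> \<theta>s < \<delta> \<longrightarrow> norm (dl \<theta> x - dl \<theta>s x) \<le> \<rho> k x" for k
    proof (intro exI conjI)
      show "0 < r / real (Suc k)" using r by simp
      show "AE x in P. \<forall>\<theta>. dist \<theta> \<theta>s < r / real (Suc k) \<longrightarrow> norm (dl \<theta> x - dl \<theta>s x) \<le> \<rho> k x"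
        using \<rho>(3)[of k] sub
      proof (eventually_elim, safe)
        fix x \<theta>
        assume R: "\<forall>p\<in>V k. h p x \<le> \<rho> k x"
          and sub: "\<forall>\<theta>\<in>U. dl \<theta> x \<in> clarke_subdifferential (\<lambda>\<theta>. l \<theta> x) \<theta>"
          and "dist \<theta> \<theta>s < r / real (Suc k)"
        then have \<theta>: "\<theta> \<in> B k" by (simp add: B_def dist_commute)
        show "norm (dl \<theta> x - dl \<theta>s x) \<le> \<rho> k x"
        \<comment> \<open>B k is an open neighbourhood of \<theta> as well as of
          \<open>\<theta>s\<close>, so the increment bound on B k tests the subgradient at \<theta>
          against the fixed vector \<open>dl \<theta>s x\<close>.\<close>
        proof (rule clarke_subdifferential_norm_diff_le[OF _ B(1) \<theta> \<rho>(2)])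
          show "dl \<theta> x \<in> clarke_subdifferential (\<lambda>\<theta>. l \<theta> x) \<theta>" using sub \<theta> B(3) by blast
          fix y z assume yz: "y \<in> B k" "z \<in> B k"
          show "l y x - l z x \<le> dl \<theta>s x \<bullet> (y - z) + \<rho> k x * norm (y - z)"
          proof (cases "y = z")
            case False
            then have "h (y, z) x \<le> \<rho> k x" using R yz by (auto simp: V_def)
            then have "\<bar>l y x - l z x - dl \<theta>s x \<bullet> (y - z)\<bar> \<le> \<rho> k x * norm (y - z)"
              using False by (simp add: h_def pos_divide_le_eq)
            then show ?thesis by linarith
          qed simp
        qed
      qed
    qed
    have "AE x in P. \<forall>k. (\<forall>p\<in>V k. h p x \<le> \<rho> k x) \<and> (\<forall>b\<ge>0. (\<forall>p\<in>V k. h p x \<le> b) \<longrightarrow> \<rho> k x \<le> b)"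
      using \<rho>(3) by (simp add: AE_all_countable)
    then show "AE x in P. norm (dl \<theta>s x) \<le> 2 * \<bar>L x\<bar> \<and> (\<forall>k. 0 \<le> \<rho> k x \<and> \<rho> k x \<le> 2 * \<bar>L x\<bar>) \<and>
        (\<lambda>k. \<rho> k x) \<longlonglongrightarrow> 0"
      using dl_le h_le sub sd
    proof eventually_elim
      case (elim x)
      have "(\<lambda>k. \<rho> k x) \<longlonglongrightarrow> 0"
      proof (rule LIMSEQ_I)
        fix \<epsilon> :: real assume "0 < \<epsilon>"
        then have "0 < \<epsilon> / 2" by simp
        moreover have "dl \<theta>s x \<in> clarke_subdifferential (\<lambda>\<theta>. l \<theta> x) \<theta>s" using elim U by blast
        ultimately obtain \<delta> where \<delta>: "0 < \<delta>"
          "\<And>y z. y \<in> ball \<theta>s \<delta> \<Longrightarrow> z \<in> ball \<theta>s \<delta> \<Longrightarrow>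
            \<bar>l y x - l z x - dl \<theta>s x \<bullet> (y - z)\<bar> \<le> \<epsilon> / 2 * norm (y - z)"
          using strictly_differentiable_clarke_gradient[OF elim(5)] by blast
        have "(\<lambda>k. r / real (Suc k)) \<longlonglongrightarrow> 0"
          using LIMSEQ_Suc[OF lim_const_over_n[of r]] by simp
        then have "\<forall>\<^sub>F k in sequentially. r / real (Suc k) < \<delta>"
          using \<delta>(1) by (rule order_tendstoD(2))
        then obtain K where K: "\<And>k. K \<le> k \<Longrightarrow> r / real (Suc k) < \<delta>"
          unfolding eventually_sequentially by blast
        have "norm (\<rho> k x - 0) < \<epsilon>" if "K \<le> k" for k
        proof -
          \<comment> \<open>For large k all pairs lie in the ball where strict differentiability
            bounds the quotients by \<epsilon>/2; minimality of \<rho> k passes this bound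
            on.\<close>
          have sub: "B k \<subseteq> ball \<theta>s \<delta>" unfolding B_def using K[OF that] by (intro subset_ball) simp
          have "h p x \<le> \<epsilon> / 2" if "p \<in> V k" for p
          proof -
            have "fst p \<in> ball \<theta>s \<delta>" "snd p \<in> ball \<theta>s \<delta>" "fst p \<noteq> snd p"
              using that sub unfolding V_def by blast+
            then show ?thesis using \<delta>(2)[of "fst p" "snd p"] unfolding h_def by (simp add: pos_divide_le_eq)
          qed
          moreover have "0 \<le> \<epsilon> / 2" using \<open>0 < \<epsilon>\<close> by simp
          ultimately have "\<rho> k x \<le> \<epsilon> / 2" using elim(1) by blast
          then show ?thesis using \<rho>(2)[of k x] \<open>0 < \<epsilon>\<close> by simp
        qed
        then show "\<exists>no. \<forall>n\<ge>no. norm (\<rho> n x - 0) < \<epsilon>" by blast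
      qed
      moreover have "\<rho> k x \<le> 2 * \<bar>L x\<bar>" for k
      proof -
        have "0 \<le> 2 * \<bar>L x\<bar>" by simp
        then show ?thesis using elim(1,3) by blast
      qed
      ultimately show ?case using \<rho>(2) elim(2) by simp
    qed
  qed (use dl \<rho>(1) in auto)
qed

text \<open>Meant for \<open>M\<close> and its Jacobian. Here the family itself is continuous in
  \<theta>, so its oscillation over B k is already a supremum of continuous functions and can serve
  as the modulus.\<close>

lemma loc_dominated_continuous:
  fixes f :: "'a::{metric_space, second_countable_topology} \<Rightarrow> 'x \<Rightarrow> 'b::euclidean_space"
  assumes U: "open U" "a \<in> U" and meas: "\<And>\<theta>. \<theta> \<in> U \<Longrightarrow> f \<theta> \<in> borel_measurable P"
    and cont: "AE x in P. continuous_on U (\<lambda>\<theta>. f \<theta> x)"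
    and F: "F \<in> borel_measurable P" "integrable P (\<lambda>x. F x ^ p)"
    and le: "AE x in P. \<forall>\<theta>\<in>U. norm (f \<theta> x) \<le> F x"
  shows "loc_dominated P p a f"
proof -
  obtain r where r: "0 < r" "ball a r \<subseteq> U"
    using U by (auto simp: open_contains_ball)
  define B where "B k = ball a (r / real (Suc k))" for k
  have B: "open (B k)" "a \<in> B k" "B k \<subseteq> U" for k
  proof -
    have "r / real (Suc k) \<le> r" using r(1) by (simp add: divide_le_eq)
    then show "B k \<subseteq> U" unfolding B_def using r(2) by (meson subset_ball subset_trans)
  qed (use r in \<open>simp_all add: B_def\<close>)
  define h where "h \<theta> x = norm (f \<theta> x - f a x)" for \<theta> x
  have h_meas: "h \<theta> \<in> borel_measurable P" if "\<theta> \<in> B k" for \<theta> k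
  proof -
    have [measurable]: "f \<theta> \<in> borel_measurable P" "f a \<in> borel_measurable P"
      using that B(3)[of k] meas U(2) by blast+
    show ?thesis unfolding h_def by measurable
  qed
  have h_cont: "AE x in P. continuous_on (B k) (\<lambda>\<theta>. h \<theta> x)" for k
    using cont unfolding h_def
    by eventually_elim (intro continuous_intros continuous_on_subset[OF _ B(3)])
  have h_le: "AE x in P. \<forall>k. \<forall>\<theta>\<in>B k. h \<theta> x \<le> 2 * F x"
    using le
  proof (eventually_elim, intro allI ballI)
    fix x k \<theta> assume "\<forall>\<theta>\<in>U. norm (f \<theta> x) \<le> F x" "\<theta> \<in> B k"
    then have "norm (f \<theta> x) \<le> F x" "norm (f a x) \<le> F x" using B(3) U(2) by blast+
    then show "h \<theta> x \<le> 2 * F x" unfolding h_def using norm_triangle_ineq4[of "f \<theta> x" "f a x"] by linarith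
  qed
  have "\<exists>R. R \<in> borel_measurable P \<and> (\<forall>x. 0 \<le> R x) \<and>
      (AE x in P. (\<forall>\<theta>\<in>B k. h \<theta> x \<le> R x) \<and> (\<forall>b\<ge>0. (\<forall>\<theta>\<in>B k. h \<theta> x \<le> b) \<longrightarrow> R x \<le> b))" for k
  proof (rule measurable_sup_continuous_AE[where h=h and P=P, OF B(1)[of k] h_meas h_cont])
    show "AE x in P. \<exists>b. \<forall>\<theta>\<in>B k. h \<theta> x \<le> b"
      using h_le by eventually_elim blast
  qed (assumption, rule exI, intro conjI allI, assumption+)
  then have "\<forall>k. \<exists>R. R \<in> borel_measurable P \<and> (\<forall>x. 0 \<le> R x) \<and>
      (AE x in P. (\<forall>\<theta>\<in>B k. h \<theta> x \<le> R x) \<and> (\<forall>b\<ge>0. (\<forall>\<theta>\<in>B k. h \<theta> x \<le> b) \<longrightarrow> R x \<le> b))"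
    by (rule allI)
  from choice[OF this] obtain \<rho> where "\<forall>k. \<rho> k \<in> borel_measurable P \<and> (\<forall>x. 0 \<le> \<rho> k x) \<and>
      (AE x in P. (\<forall>\<theta>\<in>B k. h \<theta> x \<le> \<rho> k x) \<and> (\<forall>b\<ge>0. (\<forall>\<theta>\<in>B k. h \<theta> x \<le> b) \<longrightarrow> \<rho> k x \<le> b))" ..
  then have \<rho>: "\<rho> k \<in> borel_measurable P" "0 \<le> \<rho> k x"
    "AE x in P. (\<forall>\<theta>\<in>B k. h \<theta> x \<le> \<rho> k x) \<and> (\<forall>b\<ge>0. (\<forall>\<theta>\<in>B k. h \<theta> x \<le> b) \<longrightarrow> \<rho> k x \<le> b)" for k x
    by simp_all
  show ?thesis
  proof (rule loc_dominatedI[where F="\<lambda>x. 2 * F x" and \<rho>=\<rho>])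
    show "integrable P (\<lambda>x. (2 * F x) ^ p)" using F(2) by (simp add: power_mult_distrib)
    show "\<exists>\<delta>>0. AE x in P. \<forall>\<theta>. dist \<theta> a < \<delta> \<longrightarrow> norm (f \<theta> x - f a x) \<le> \<rho> k x" for k
    proof (intro exI conjI)
      show "0 < r / real (Suc k)" using r by simp
      show "AE x in P. \<forall>\<theta>. dist \<theta> a < r / real (Suc k) \<longrightarrow> norm (f \<theta> x - f a x) \<le> \<rho> k x"
        using \<rho>(3)[of k] by eventually_elim (auto simp: B_def h_def dist_commute)
    qed
    have "AE x in P. \<forall>k. (\<forall>\<theta>\<in>B k. h \<theta> x \<le> \<rho> k x) \<and> (\<forall>b\<ge>0. (\<forall>\<theta>\<in>B k. h \<theta> x \<le> b) \<longrightarrow> \<rho> k x \<le> b)"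
      using \<rho>(3) by (simp add: AE_all_countable)
    then show "AE x in P. norm (f a x) \<le> 2 * F x \<and> (\<forall>k. 0 \<le> \<rho> k x \<and> \<rho> k x \<le> 2 * F x) \<and>
        (\<lambda>k. \<rho> k x) \<longlonglongrightarrow> 0"
      using le h_le cont
    proof eventually_elim
      case (elim x)
      have fa: "norm (f a x) \<le> F x" using elim(2) U(2) by blast
      then have F0: "0 \<le> F x" using norm_ge_zero order_trans by blast
      have "(\<lambda>k. \<rho> k x) \<longlonglongrightarrow> 0"
      proof (rule LIMSEQ_I)
        fix \<epsilon> :: real assume "0 < \<epsilon>"
        then have "0 < \<epsilon> / 2" by simp
        moreover have "isCont (\<lambda>\<theta>. f \<theta> x) a"
          using elim(4) U by (simp add: continuous_on_eq_continuous_at)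
        ultimately obtain \<delta> where \<delta>: "0 < \<delta>" "\<And>\<theta>. dist \<theta> a < \<delta> \<Longrightarrow> dist (f \<theta> x) (f a x) < \<epsilon> / 2"
          unfolding continuous_at_eps_delta by blast
        have "(\<lambda>k. r / real (Suc k)) \<longlonglongrightarrow> 0"
          using LIMSEQ_Suc[OF lim_const_over_n[of r]] by simp
        then have "\<forall>\<^sub>F k in sequentially. r / real (Suc k) < \<delta>"
          using \<delta>(1) by (rule order_tendstoD(2))
        then obtain K where K: "\<And>k. K \<le> k \<Longrightarrow> r / real (Suc k) < \<delta>"
          unfolding eventually_sequentially by blast
        have "norm (\<rho> k x - 0) < \<epsilon>" if "K \<le> k" for k
        proof -
          have "h \<theta> x \<le> \<epsilon> / 2" if "\<theta> \<in> B k" for \<theta>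
            using \<delta>(2)[of \<theta>] K[OF \<open>K \<le> k\<close>] that unfolding h_def B_def
            by (simp add: dist_commute) (simp add: dist_norm)
          moreover have "0 \<le> \<epsilon> / 2" using \<open>0 < \<epsilon>\<close> by simp
          ultimately have "\<rho> k x \<le> \<epsilon> / 2" using elim(1) by blast
          then show ?thesis using \<rho>(2)[of k x] \<open>0 < \<epsilon>\<close> by simp
        qed
        then show "\<exists>no. \<forall>n\<ge>no. norm (\<rho> n x - 0) < \<epsilon>" by blast
      qed
      moreover have "\<rho> k x \<le> 2 * F x" for k
      proof -
        have "0 \<le> 2 * F x" using F0 by simp
        then show ?thesis using elim(1,3) by blast
      qed
      ultimately show ?case using \<rho>(2) fa F0 by simp
    qed
  qed (use meas U(2) F(1) \<rho>(1) in auto)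
qed

section \<open>The Jacobian: measurability and differentiation under the integral sign\<close>

lemma borel_measurable_jacobian:
  fixes M :: "real^'d \<Rightarrow> 'x \<Rightarrow> real^'m"
  assumes "open N" "\<theta> \<in> N" and meas: "\<And>\<theta>. \<theta> \<in> N \<Longrightarrow> M \<theta> \<in> borel_measurable P"
    and diff: "\<And>x. x \<in> space P \<Longrightarrow> (\<lambda>\<theta>. M \<theta> x) differentiable (at \<theta>)"
  shows "(\<lambda>x. jacobian (\<lambda>\<theta>. M \<theta> x) (at \<theta>)) \<in> borel_measurable P"
proof -
  obtain r where r: "0 < r" "ball \<theta> r \<subseteq> N"
    using assms by (auto simp: open_contains_ball)
  \<comment> \<open>Halving r keeps even t 0 strictly below r, so every shifted point stays in
    N.\<close>
  define t where "t k = r / 2 / real (Suc k)" for k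
  have t: "0 < t k" "t k < r" for k
  proof -
    have "r / 2 / real (Suc k) \<le> r / 2" using r(1) by (simp add: divide_le_eq)
    then show "t k < r" using r(1) unfolding t_def by linarith
  qed (use r in \<open>simp add: t_def\<close>)
  have t0: "t \<longlonglongrightarrow> 0"
    using LIMSEQ_Suc[OF lim_const_over_n[of "r / 2"]] by (simp add: t_def[abs_def])
  \<comment> \<open>Along a coordinate direction the difference quotients are measurable in x, and
    the entry of the Jacobian is their limit.\<close>
  have entry: "(\<lambda>x. jacobian (\<lambda>\<theta>. M \<theta> x) (at \<theta>) $ i $ j) \<in> borel_measurable P" for i j
  proof (rule borel_measurable_LIMSEQ_real)
    fix k
    have "\<theta> + t k *\<^sub>R axis j 1 \<in> N" "\<theta> \<in> N"
      using r(2) t[of k] assms(2) by (auto simp: dist_norm)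
    then have [measurable]: "M (\<theta> + t k *\<^sub>R axis j 1) \<in> borel_measurable P" "M \<theta> \<in> borel_measurable P"
      using meas by auto
    show "(\<lambda>x. (M (\<theta> + t k *\<^sub>R axis j 1) x $ i - M \<theta> x $ i) / t k) \<in> borel_measurable P"
      unfolding cart_eq_inner_axis by measurable
  next
    fix x assume "x \<in> space P"
    then have M: "((\<lambda>\<theta>. M \<theta> x) has_derivative (*v) (jacobian (\<lambda>\<theta>. M \<theta> x) (at \<theta>))) (at (\<theta> + 0 *\<^sub>R axis j 1))"
      using diff jacobian_works by auto
    have "((\<lambda>s::real. \<theta> + s *\<^sub>R axis j 1) has_derivative (\<lambda>s. s *\<^sub>R axis j 1)) (at 0)"
      by (auto intro!: derivative_eq_intros)
    then have "((\<lambda>s. M (\<theta> + s *\<^sub>R axis j 1) x) has_derivative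
        (\<lambda>s. jacobian (\<lambda>\<theta>. M \<theta> x) (at \<theta>) *v (s *\<^sub>R axis j 1))) (at 0)"
      using M by (rule has_derivative_compose)
    then have "((\<lambda>s. M (\<theta> + s *\<^sub>R axis j 1) x) has_vector_derivative
        jacobian (\<lambda>\<theta>. M \<theta> x) (at \<theta>) *v axis j 1) (at 0)"
      unfolding has_vector_derivative_def by (simp add: matrix_vector_mult_scaleR)
    then have "((\<lambda>s. M (\<theta> + s *\<^sub>R axis j 1) x $ i) has_real_derivative
        (jacobian (\<lambda>\<theta>. M \<theta> x) (at \<theta>) *v axis j 1) $ i) (at 0)"
      unfolding has_real_derivative_iff_has_vector_derivative
      by (rule bounded_linear.has_vector_derivative[OF bounded_linear_vec_nth])
    moreover have "(jacobian (\<lambda>\<theta>. M \<theta> x) (at \<theta>) *v axis j 1) $ i = jacobian (\<lambda>\<theta>. M \<theta> x) (at \<theta>) $ i $ j"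
      by (simp add: matrix_vector_mult_basis column_def)
    ultimately have "(\<lambda>s. (M (\<theta> + s *\<^sub>R axis j 1) x $ i - M \<theta> x $ i) / s) \<midarrow>0\<rightarrow>
        jacobian (\<lambda>\<theta>. M \<theta> x) (at \<theta>) $ i $ j"
      by (simp add: DERIV_def)
    moreover have "filterlim t (at 0) sequentially"
      unfolding filterlim_at using t0 less_imp_neq[OF t(1)] by (intro conjI always_eventually allI) (simp, metis, assumption)
    ultimately show "(\<lambda>k. (M (\<theta> + t k *\<^sub>R axis j 1) x $ i - M \<theta> x $ i) / t k) \<longlonglongrightarrow>
        jacobian (\<lambda>\<theta>. M \<theta> x) (at \<theta>) $ i $ j"
      by (rule filterlim_compose)
  qed
  show ?thesis
    unfolding borel_measurable_euclidean_space[of "\<lambda>x. jacobian (\<lambda>\<theta>. M \<theta> x) (at \<theta>)"]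
    using entry by (auto simp: Basis_vec_def inner_axis)
qed

text \<open>Needed to identify the limit of the empirical mean Jacobian with the derivative of
  \<open>mu\<close> that occurs in \<open>Mtilde\<close>. The mean value inequality on a convex ball
  bounds the linearization error of M at each x by the oscillation of its Jacobian, and the modulus
  \<rho> k makes that error small in mean, uniformly over directions.\<close>

lemma has_derivative_mu:
  fixes M :: "real^'d \<Rightarrow> 'x \<Rightarrow> real^'m"
  assumes N: "open N" "\<theta>s \<in> N" and int: "\<And>\<theta>. \<theta> \<in> N \<Longrightarrow> integrable P (M \<theta>)"
    and diff: "\<And>x \<theta>. x \<in> space P \<Longrightarrow> \<theta> \<in> N \<Longrightarrow> (\<lambda>\<theta>. M \<theta> x) differentiable (at \<theta>)"
    and J: "loc_dominated P 1 \<theta>s (\<lambda>\<theta> x. jacobian (\<lambda>\<theta>. M \<theta> x) (at \<theta>))"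
  shows "(mu P M has_derivative (\<lambda>v. (\<integral>x. jacobian (\<lambda>\<theta>. M \<theta> x) (at \<theta>s) \<partial>P) *v v)) (at \<theta>s)"
  unfolding has_derivative_within_alt
proof (intro conjI allI impI)
  define J where "J \<theta> x = jacobian (\<lambda>\<theta>. M \<theta> x) (at \<theta>)" for \<theta> x
  interpret mv: bounded_bilinear "(*v) :: real^'d^'m \<Rightarrow> real^'d \<Rightarrow> real^'m"
    by (rule bounded_bilinear_matrix_vector_mult)
  show "bounded_linear ((*v) (\<integral>x. jacobian (\<lambda>\<theta>. M \<theta> x) (at \<theta>s) \<partial>P))" by simp
  fix e :: real assume "0 < e"
  obtain K where K: "0 < K" "\<And>A v. norm (A *v v :: real^'m) \<le> norm A * norm (v :: real^'d) * K"
    using mv.pos_bounded by blast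
  have J1: "loc_dominated P 1 \<theta>s J" using assms(5) unfolding J_def[abs_def] .
  then obtain F \<rho> where *: "J \<theta>s \<in> borel_measurable P" "F \<in> borel_measurable P"
    "integrable P (\<lambda>x. F x ^ 1)" "\<And>k. \<rho> k \<in> borel_measurable P"
    "\<And>k::nat. \<exists>\<delta>>0. AE x in P. \<forall>\<theta>. dist \<theta> \<theta>s < \<delta> \<longrightarrow> norm (J \<theta> x - J \<theta>s x) \<le> \<rho> k x"
    "AE x in P. norm (J \<theta>s x) \<le> F x \<and> (\<forall>k. 0 \<le> \<rho> k x \<and> \<rho> k x \<le> F x) \<and> (\<lambda>k. \<rho> k x) \<longlonglongrightarrow> 0"
    by (rule loc_dominatedE) blast
  have F: "integrable P F" using *(3) by simp
  have le: "AE x in P. norm (\<rho> k x) \<le> F x" for k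
    using *(6) by eventually_elim simp
  have "(\<lambda>k. \<integral>x. \<rho> k x \<partial>P) \<longlonglongrightarrow> (\<integral>x. 0 \<partial>P)"
    by (rule integral_dominated_convergence[OF _ *(4) F _ le]) (use *(6) in auto)
  \<comment> \<open>K is the constant in |A v| <= K |A| |v|. It is divided out here so that the
    final error is e.\<close>
  then have "\<forall>\<^sub>F k in sequentially. (\<integral>x. \<rho> k x \<partial>P) < e / K"
    using \<open>0 < e\<close> K(1) by (intro order_tendstoD(2)) auto
  then obtain k where k: "(\<integral>x. \<rho> k x \<partial>P) < e / K" by (auto simp: eventually_sequentially)
  have int_\<rho>: "integrable P (\<rho> k)"
  proof (rule Bochner_Integration.integrable_bound[OF F *(4)])
    show "AE x in P. norm (\<rho> k x) \<le> norm (F x)"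
      using le[of k] by eventually_elim simp
  qed
  have int_J: "integrable P (J \<theta>s)" by (rule loc_dominated_integrable[OF J1])
  obtain d where d: "0 < d" "AE x in P. \<forall>\<theta>. dist \<theta> \<theta>s < d \<longrightarrow> norm (J \<theta> x - J \<theta>s x) \<le> \<rho> k x"
    using *(5)[of k] by blast
  obtain r where r: "0 < r" "ball \<theta>s r \<subseteq> N" using N by (auto simp: open_contains_ball)
  have "norm (mu P M \<theta> - mu P M \<theta>s - (\<integral>x. J \<theta>s x \<partial>P) *v (\<theta> - \<theta>s)) \<le> e * norm (\<theta> - \<theta>s)"
    if \<theta>: "norm (\<theta> - \<theta>s) < min d r" for \<theta>
  proof -
    \<comment> \<open>The radius d keeps the oscillation bound in force, and r keeps the ball inside
      N, where M is differentiable.\<close>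
    let ?B = "ball \<theta>s (min d r)"
    have \<theta>B: "\<theta> \<in> ?B" "?B \<subseteq> N" using \<theta> r(2) by (auto simp: dist_norm norm_minus_commute)
    have lin: "(\<integral>x. J \<theta>s x *v (\<theta> - \<theta>s) \<partial>P) = (\<integral>x. J \<theta>s x \<partial>P) *v (\<theta> - \<theta>s)"
      "integrable P (\<lambda>x. J \<theta>s x *v (\<theta> - \<theta>s))"
      using integral_bounded_linear[OF mv.bounded_linear_left int_J]
        integrable_bounded_linear[OF mv.bounded_linear_left int_J] by auto
    have int_M: "integrable P (M \<theta>)" "integrable P (M \<theta>s)" using int \<theta>B N by blast+
    have bound: "AE x in P. norm (M \<theta> x - M \<theta>s x - J \<theta>s x *v (\<theta> - \<theta>s)) \<le> norm (\<theta> - \<theta>s) * (\<rho> k x * K)"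
      using d(2) AE_space
    proof eventually_elim
      case (elim x)
      show ?case
      proof (rule differentiable_bound_linearization[where S="?B" and f'="\<lambda>\<theta> v. J \<theta> x *v v" and f="\<lambda>\<theta>. M \<theta> x"])
        fix t :: real assume "t \<in> {0..1}"
        then have "norm (t *\<^sub>R (\<theta> - \<theta>s)) \<le> norm (\<theta> - \<theta>s)" by (simp add: mult_left_le_one_le)
        then show "\<theta>s + t *\<^sub>R (\<theta> - \<theta>s) \<in> ?B" using \<theta> by (simp add: dist_norm)
      next
        fix y assume y: "y \<in> ?B"
        then have "(\<lambda>\<theta>. M \<theta> x) differentiable (at y)" using diff elim(2) \<theta>B by blast
        then show "((\<lambda>\<theta>. M \<theta> x) has_derivative (*v) (J y x)) (at y within ?B)"
          unfolding J_def jacobian_works by (rule has_derivative_at_withinI)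
        have "norm (J y x - J \<theta>s x) \<le> \<rho> k x" using elim(1) y by (simp add: dist_commute)
        then have "norm (J y x - J \<theta>s x) * norm v * K \<le> \<rho> k x * norm v * K" for v :: "real^'d"
          using K(1) by (intro mult_right_mono) simp_all
        then have "norm ((J y x - J \<theta>s x) *v v) \<le> \<rho> k x * norm v * K" for v
          using K(2) order_trans by blast
        then have "norm ((J y x - J \<theta>s x) *v v) \<le> \<rho> k x * K * norm v" for v
          by (simp only: mult_ac)
        then show "onorm ((*v) (J y x) - (*v) (J \<theta>s x)) \<le> \<rho> k x * K"
          by (intro onorm_le) (simp add: mv.diff_left)
      qed (use d(1) r(1) in auto)
    qed
    have "mu P M \<theta> - mu P M \<theta>s - (\<integral>x. J \<theta>s x \<partial>P) *v (\<theta> - \<theta>s)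
        = (\<integral>x. M \<theta> x - M \<theta>s x - J \<theta>s x *v (\<theta> - \<theta>s) \<partial>P)"
      unfolding mu_def lin(1)[symmetric] using int_M lin(2) by simp
    also have "norm \<dots> \<le> (\<integral>x. norm (M \<theta> x - M \<theta>s x - J \<theta>s x *v (\<theta> - \<theta>s)) \<partial>P)"
      by (rule integral_norm_bound)
    also have "\<dots> \<le> (\<integral>x. norm (\<theta> - \<theta>s) * (\<rho> k x * K) \<partial>P)"
      using int_M lin(2) int_\<rho> bound by (intro integral_mono_AE) auto
    also have "\<dots> = norm (\<theta> - \<theta>s) * ((\<integral>x. \<rho> k x \<partial>P) * K)" by simp
    also have "\<dots> \<le> norm (\<theta> - \<theta>s) * e"
      using k K(1) by (intro mult_left_mono) (auto simp: field_simps)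
    finally show ?thesis by (simp add: mult.commute)
  qed
  then show "\<exists>d>0. \<forall>y\<in>UNIV. norm (y - \<theta>s) < d \<longrightarrow>
      norm (mu P M y - mu P M \<theta>s - (\<integral>x. jacobian (\<lambda>\<theta>. M \<theta> x) (at \<theta>s) \<partial>P) *v (y - \<theta>s)) \<le> e * norm (y - \<theta>s)"
    using d(1) r(1) unfolding J_def by (intro exI[of _ "min d r"]) auto
qed

section \<open>Consistency of the plug-in estimator\<close>

text \<open>On a compact set away from \<open>\<theta>s\<close> the continuous risk exceeds its
  minimum by a gap \<delta>. Pointwise laws at the centres of a finite cover, together with the
  Lipschitz bound between a centre and the EO solution, carry the gap over to the empirical risk.
  Tightness supplies the compact set.\<close>

lemma (in iid) conv_prob_near_minimizer:
  fixes l :: "'a::real_normed_vector \<Rightarrow> 'x \<Rightarrow> real"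
  assumes int: "\<And>\<theta>. \<theta> \<in> \<Theta> \<Longrightarrow> integrable P (l \<theta>)" and \<theta>s: "\<theta>s \<in> \<Theta>"
    and min: "\<And>\<theta>. \<theta> \<in> \<Theta> \<Longrightarrow> \<theta> \<noteq> \<theta>s \<Longrightarrow> risk P l \<theta>s < risk P l \<theta>"
    and L: "integrable P L"
    and lip: "AE x in P. \<forall>\<theta>1\<in>\<Theta>. \<forall>\<theta>2\<in>\<Theta>. \<bar>l \<theta>1 x - l \<theta>2 x\<bar> \<le> L x * norm (\<theta>1 - \<theta>2)"
    and r: "small_op S (\<lambda>n \<omega>. real n * r n \<omega>)"
    and near: "\<And>n. 1 \<le> n \<Longrightarrow> AE \<omega> in S. \<forall>\<theta>\<in>\<Theta>. emp \<xi> n \<omega> (l (\<theta>h n \<omega>)) \<le> emp \<xi> n \<omega> (l \<theta>) + r n \<omega>"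
    and tight: "tight_in S \<Theta> \<theta>h"
  shows "conv_prob S \<theta>h \<theta>s"
proof -
  define Lm where "Lm = (\<integral>x. \<bar>L x\<bar> \<partial>P)"
  have Lm: "0 \<le> Lm" unfolding Lm_def by simp
  have absL: "integrable P (\<lambda>x. \<bar>L x\<bar>)" using L by simp
  have lip': "AE x in P. \<forall>\<theta>1\<in>\<Theta>. \<forall>\<theta>2\<in>\<Theta>. \<bar>l \<theta>1 x - l \<theta>2 x\<bar> \<le> \<bar>L x\<bar> * norm (\<theta>1 - \<theta>2)"
    using lip
  proof (eventually_elim, intro ballI)
    fix x \<theta>1 \<theta>2 assume "\<forall>\<theta>1\<in>\<Theta>. \<forall>\<theta>2\<in>\<Theta>. \<bar>l \<theta>1 x - l \<theta>2 x\<bar> \<le> L x * norm (\<theta>1 - \<theta>2)" "\<theta>1 \<in> \<Theta>" "\<theta>2 \<in> \<Theta>"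
    then have "\<bar>l \<theta>1 x - l \<theta>2 x\<bar> \<le> L x * norm (\<theta>1 - \<theta>2)" by blast
    also have "\<dots> \<le> \<bar>L x\<bar> * norm (\<theta>1 - \<theta>2)" by (intro mult_right_mono) auto
    finally show "\<bar>l \<theta>1 x - l \<theta>2 x\<bar> \<le> \<bar>L x\<bar> * norm (\<theta>1 - \<theta>2)" .
  qed
  have "Lm-lipschitz_on \<Theta> (risk P l)"
  proof (rule lipschitz_onI)
    fix \<theta>1 \<theta>2 assume \<theta>: "\<theta>1 \<in> \<Theta>" "\<theta>2 \<in> \<Theta>"
    have "dist (risk P l \<theta>1) (risk P l \<theta>2) = \<bar>\<integral>x. l \<theta>1 x - l \<theta>2 x \<partial>P\<bar>"
      using int[OF \<theta>(1)] int[OF \<theta>(2)] by (simp add: risk_def dist_real_def)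
    also have "\<dots> \<le> (\<integral>x. \<bar>l \<theta>1 x - l \<theta>2 x\<bar> \<partial>P)"
      using integral_norm_bound[of P "\<lambda>x. l \<theta>1 x - l \<theta>2 x"] by simp
    also have "\<dots> \<le> (\<integral>x. \<bar>L x\<bar> * norm (\<theta>1 - \<theta>2) \<partial>P)"
    proof (rule integral_mono_AE)
      show "AE x in P. \<bar>l \<theta>1 x - l \<theta>2 x\<bar> \<le> \<bar>L x\<bar> * norm (\<theta>1 - \<theta>2)"
        using lip' by eventually_elim (use \<theta> in blast)
    qed (use int \<theta> absL in auto)
    finally show "dist (risk P l \<theta>1) (risk P l \<theta>2) \<le> Lm * dist \<theta>1 \<theta>2"
      using absL by (simp add: Lm_def dist_norm)
  qed (rule Lm)
  then have cont: "continuous_on \<Theta> (risk P l)" by (rule lipschitz_on_continuous_on)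
  have on_compact: "whp S (\<lambda>n \<omega>. \<theta>h n \<omega> \<in> K \<longrightarrow> dist (\<theta>h n \<omega>) \<theta>s < \<epsilon>)"
    if K: "compact K" "K \<subseteq> \<Theta>" and "0 < \<epsilon>" for K \<epsilon>
  proof (cases "K - ball \<theta>s \<epsilon> = {}")
    case True
    then have "\<theta> \<in> K \<longrightarrow> dist \<theta> \<theta>s < \<epsilon>" for \<theta> by (auto simp: dist_commute)
    then show ?thesis by (intro whp_AE) simp
  next
    case False
    define K' where "K' = K - ball \<theta>s \<epsilon>"
    have K': "compact K'" "K' \<subseteq> \<Theta>" "K' \<noteq> {}"
      using K False by (auto simp: K'_def intro: compact_diff)
    obtain \<theta>0 where \<theta>0: "\<theta>0 \<in> K'" "\<And>\<theta>. \<theta> \<in> K' \<Longrightarrow> risk P l \<theta>0 \<le> risk P l \<theta>"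
      using continuous_attains_inf[OF K'(1,3) continuous_on_subset[OF cont K'(2)]] by blast
    define \<delta> where "\<delta> = risk P l \<theta>0 - risk P l \<theta>s"
    have "\<theta>0 \<noteq> \<theta>s" using \<theta>0(1) \<open>0 < \<epsilon>\<close> by (auto simp: K'_def)
    then have \<delta>: "0 < \<delta>" unfolding \<delta>_def using min[of \<theta>0] \<theta>0(1) K'(2) by auto
    \<comment> \<open>With high probability the empirical mean of |L| is below Lm + 1, so a move by
      less than \<rho> changes the empirical risk by at most \<delta>/8.\<close>
    define \<rho> where "\<rho> = \<delta> / (8 * (Lm + 1))"
    have \<rho>: "0 < \<rho>" "(Lm + 1) * \<rho> = \<delta> / 8" using \<delta> Lm by (auto simp: \<rho>_def field_simps)
    have "K' \<subseteq> (\<Union>t\<in>K'. ball t \<rho>)" using \<rho>(1) by auto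
    \<comment> \<open>The centres are taken in \<open>K'\<close> itself, so that both the gap and
      the Lipschitz bound hold at them.\<close>
    then obtain T where T: "T \<subseteq> K'" "finite T" "K' \<subseteq> (\<Union>t\<in>T. ball t \<rho>)"
      using compactE_image[OF K'(1), of K' "\<lambda>t. ball t \<rho>"] by (auto simp del: mem_ball)
    have \<delta>8: "0 < \<delta> / 8" using \<delta> by simp
    have wT: "whp S (\<lambda>n \<omega>. \<forall>t\<in>T. dist (emp \<xi> n \<omega> (l t)) (\<integral>x. l t x \<partial>P) < \<delta> / 8)"
      using T(1) K'(2) by (intro whp_ball_finite[OF T(2)] conv_probD[OF weak_law \<delta>8] int) auto
    have ws: "whp S (\<lambda>n \<omega>. dist (emp \<xi> n \<omega> (l \<theta>s)) (\<integral>x. l \<theta>s x \<partial>P) < \<delta> / 8)"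
      by (rule conv_probD[OF weak_law[OF int[OF \<theta>s]] \<delta>8])
    have wL: "whp S (\<lambda>n \<omega>. dist (emp \<xi> n \<omega> (\<lambda>x. \<bar>L x\<bar>)) Lm < 1)"
      unfolding Lm_def by (rule conv_probD[OF weak_law[OF absL]]) simp
    have "whp S (\<lambda>n \<omega>. \<bar>real n * r n \<omega>\<bar> \<le> \<delta> / 8)"
      using r \<delta>8 unfolding small_op_iff_whp by blast
    then have wr: "whp S (\<lambda>n \<omega>. r n \<omega> \<le> \<delta> / 8)"
    proof (rule whp_mono_eventually)
      show "\<forall>\<^sub>F n in sequentially. \<forall>\<omega>\<in>space S. \<bar>real n * r n \<omega>\<bar> \<le> \<delta> / 8 \<longrightarrow> r n \<omega> \<le> \<delta> / 8"
        using eventually_ge_at_top[of 1]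
      proof (eventually_elim, intro ballI impI)
        fix n :: nat and \<omega> assume n: "1 \<le> n" and le: "\<bar>real n * r n \<omega>\<bar> \<le> \<delta> / 8"
        have "\<bar>r n \<omega>\<bar> \<le> real n * \<bar>r n \<omega>\<bar>" using n by (simp add: mult_le_cancel_right1)
        then show "r n \<omega> \<le> \<delta> / 8" using le by (simp add: abs_mult)
      qed
    qed
    have wnear: "whp S (\<lambda>n \<omega>. \<forall>\<theta>\<in>\<Theta>. emp \<xi> n \<omega> (l (\<theta>h n \<omega>)) \<le> emp \<xi> n \<omega> (l \<theta>) + r n \<omega>)"
      using near by (intro whp_AE eventually_sequentiallyI[of 1])
    from whp_conj[OF whp_conj[OF wT ws] whp_conj[OF whp_conj[OF wL wr] whp_conj[OF wnear whp_sample[OF lip']]]]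
    show ?thesis
    proof (rule whp_mono, elim conjE)
      fix n \<omega>
      assume T': "\<forall>t\<in>T. dist (emp \<xi> n \<omega> (l t)) (\<integral>x. l t x \<partial>P) < \<delta> / 8"
        and s': "dist (emp \<xi> n \<omega> (l \<theta>s)) (\<integral>x. l \<theta>s x \<partial>P) < \<delta> / 8"
        and L': "dist (emp \<xi> n \<omega> (\<lambda>x. \<bar>L x\<bar>)) Lm < 1" and r': "r n \<omega> \<le> \<delta> / 8"
        and near': "\<forall>\<theta>\<in>\<Theta>. emp \<xi> n \<omega> (l (\<theta>h n \<omega>)) \<le> emp \<xi> n \<omega> (l \<theta>) + r n \<omega>"
        and lip'': "\<forall>i. \<forall>\<theta>1\<in>\<Theta>. \<forall>\<theta>2\<in>\<Theta>.
          \<bar>l \<theta>1 (\<xi> i \<omega>) - l \<theta>2 (\<xi> i \<omega>)\<bar> \<le> \<bar>L (\<xi> i \<omega>)\<bar> * norm (\<theta>1 - \<theta>2)"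
      show "\<theta>h n \<omega> \<in> K \<longrightarrow> dist (\<theta>h n \<omega>) \<theta>s < \<epsilon>"
      proof (intro impI, rule ccontr)
        assume "\<theta>h n \<omega> \<in> K" "\<not> dist (\<theta>h n \<omega>) \<theta>s < \<epsilon>"
        then have h: "\<theta>h n \<omega> \<in> K'" by (simp add: K'_def dist_commute)
        then obtain t where t: "t \<in> T" "dist t (\<theta>h n \<omega>) < \<rho>" using T(3) by auto
        then have tK: "t \<in> K'" using T(1) by blast
        \<comment> \<open>Four errors of \<delta>/8, for moving to the centre t, for the two laws of
          large numbers and for r, add up to \<delta>/2, which is less than the gap.\<close>
        have "norm (emp \<xi> n \<omega> (\<lambda>x. l t x - l (\<theta>h n \<omega>) x)) \<le> emp \<xi> n \<omega> (\<lambda>x. \<bar>L x\<bar> * \<rho>)"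
        proof (rule norm_emp_le)
          fix i
          have "\<bar>l t (\<xi> i \<omega>) - l (\<theta>h n \<omega>) (\<xi> i \<omega>)\<bar> \<le> \<bar>L (\<xi> i \<omega>)\<bar> * norm (t - \<theta>h n \<omega>)"
            using lip'' h tK K'(2) by blast
          also have "\<dots> \<le> \<bar>L (\<xi> i \<omega>)\<bar> * \<rho>"
            using t(2) by (intro mult_left_mono) (auto simp: dist_norm)
          finally show "norm (l t (\<xi> i \<omega>) - l (\<theta>h n \<omega>) (\<xi> i \<omega>)) \<le> \<bar>L (\<xi> i \<omega>)\<bar> * \<rho>" by simp
        qed
        also have "\<dots> \<le> (Lm + 1) * \<rho>"
          unfolding emp_mult_right using L' \<rho>(1) by (intro mult_right_mono) (auto simp: dist_real_def)
        finally have "emp \<xi> n \<omega> (l t) - emp \<xi> n \<omega> (l (\<theta>h n \<omega>)) \<le> \<delta> / 8"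
          unfolding \<rho>(2) emp_diff real_norm_def by linarith
        moreover have "risk P l t < emp \<xi> n \<omega> (l t) + \<delta> / 8"
          using T'[rule_format, OF t(1)] unfolding risk_def dist_real_def by linarith
        moreover have "emp \<xi> n \<omega> (l \<theta>s) < risk P l \<theta>s + \<delta> / 8"
          using s' unfolding risk_def dist_real_def by linarith
        moreover have "emp \<xi> n \<omega> (l (\<theta>h n \<omega>)) \<le> emp \<xi> n \<omega> (l \<theta>s) + r n \<omega>" using near' \<theta>s by blast
        moreover have "risk P l \<theta>s + \<delta> \<le> risk P l t" using \<theta>0(2)[OF tK] unfolding \<delta>_def by simp
        ultimately show False using r' \<delta> by linarith
      qed
    qed
  qed
  show ?thesis
    unfolding conv_prob_def whp_def
  proof (intro allI impI)
    fix \<epsilon> \<eta> :: real assume pos: "0 < \<epsilon>" "0 < \<eta>"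
    then have h: "0 < \<eta> / 2" by simp
    obtain K where K: "compact K" "K \<subseteq> \<Theta>"
      "\<forall>\<^sub>F n in sequentially. outer_measure_of S {\<omega> \<in> space S. \<theta>h n \<omega> \<notin> K} \<le> ennreal (\<eta> / 2)"
      using tight h unfolding tight_in_def by blast
    from K(3) whpD[OF on_compact[OF K(1,2) pos(1)] h]
    show "\<forall>\<^sub>F n in sequentially. \<exists>A\<in>sets S. emeasure S A \<le> ennreal \<eta> \<and>
        (\<forall>\<omega>\<in>space S - A. dist (\<theta>h n \<omega>) \<theta>s < \<epsilon>)"
    proof eventually_elim
      case (elim n)
      obtain A where A: "A \<in> sets S" "emeasure S A \<le> ennreal (\<eta> / 2)"
        "\<forall>\<omega>\<in>space S - A. \<theta>h n \<omega> \<in> K \<longrightarrow> dist (\<theta>h n \<omega>) \<theta>s < \<epsilon>" using elim(2) by blast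
      \<comment> \<open>The event of leaving K need not be measurable; B is a measurable cover of
        the same outer measure.\<close>
      obtain B where B: "B \<in> sets S" "{\<omega> \<in> space S. \<theta>h n \<omega> \<notin> K} \<subseteq> B"
        "outer_measure_of S {\<omega> \<in> space S. \<theta>h n \<omega> \<notin> K} = emeasure S B"
        using outer_measure_of_attain[of "{\<omega> \<in> space S. \<theta>h n \<omega> \<notin> K}" S] by auto
      have "emeasure S (A \<union> B) \<le> ennreal (\<eta> / 2) + ennreal (\<eta> / 2)"
        using A(2) B(3) elim(1) by (intro order_trans[OF emeasure_subadditive[OF A(1) B(1)]] add_mono) auto
      also have "\<dots> = ennreal \<eta>" using pos by (simp flip: ennreal_plus)
      finally show ?case using A(1,3) B(1,2) by (intro bexI[of _ "A \<union> B"]) auto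
    qed
  qed
qed

text \<open>The supremum in the moment condition need not be measurable, so its integral does not
  control it almost everywhere; the continuous minorant used here has a measurable supremum.\<close>

lemma side_information_envelope:
  fixes M :: "real^'d \<Rightarrow> 'x \<Rightarrow> real^'m"
  assumes N: "open N" and meas: "\<And>\<theta>. \<theta> \<in> N \<Longrightarrow> M \<theta> \<in> borel_measurable P"
    and diff: "\<And>x \<theta>. x \<in> space P \<Longrightarrow> \<theta> \<in> N \<Longrightarrow> (\<lambda>\<theta>. M \<theta> x) differentiable (at \<theta>)"
    and cont: "\<And>x. x \<in> space P \<Longrightarrow> continuous_on N (\<lambda>\<theta>. jacobian (\<lambda>\<theta>. M \<theta> x) (at \<theta>))"
    and fin: "(\<integral>\<^sup>+x. (SUP \<theta>\<in>N. ennreal (max (norm (M \<theta> x) ^ 3)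
           (op_norm (jacobian (\<lambda>\<theta>. M \<theta> x) (at \<theta>)) ^ 3))) \<partial>P) < \<infinity>"
  obtains G where "G \<in> borel_measurable P" "integrable P (\<lambda>x. G x ^ 3)"
    "AE x in P. \<forall>\<theta>\<in>N. norm (M \<theta> x) \<le> G x \<and> norm (jacobian (\<lambda>\<theta>. M \<theta> x) (at \<theta>)) \<le> G x"
proof -
  define J where "J \<theta> x = jacobian (\<lambda>\<theta>. M \<theta> x) (at \<theta>)" for \<theta> x
  define C where "C = real CARD('m) * real CARD('d)"
  have C: "1 \<le> C"
  proof -
    have "1 \<le> CARD('m) * CARD('d)" by (simp add: Suc_le_eq)
    then show ?thesis unfolding C_def by (metis of_nat_1 of_nat_le_iff of_nat_mult)
  qed
  have J_le: "norm (J \<theta> x) / C \<le> op_norm (J \<theta> x)" for \<theta> x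
    using norm_le_op_norm[of "J \<theta> x"] C by (simp add: C_def pos_divide_le_eq mult.commute)
  \<comment> \<open>Division by C makes h a lower bound for the integrand of the moment condition,
    so the supremum R of h has finite integral.\<close>
  define h where "h \<theta> x = max (norm (M \<theta> x) ^ 3) ((norm (J \<theta> x) / C) ^ 3)" for \<theta> x
  have h_meas: "h \<theta> \<in> borel_measurable P" if "\<theta> \<in> N" for \<theta>
  proof -
    have [measurable]: "J \<theta> \<in> borel_measurable P"
      unfolding J_def[abs_def] by (rule borel_measurable_jacobian[OF N that meas diff[OF _ that]])
    note meas[OF that, measurable]
    show ?thesis unfolding h_def by measurable
  qed
  obtain R where R [measurable]: "R \<in> borel_measurable P"
    and R_eq: "\<And>x. continuous_on N (\<lambda>\<theta>. h \<theta> x) \<Longrightarrow> R x = (SUP \<theta>\<in>N. ennreal (h \<theta> x))"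
    using measurable_SUP_continuous[where h=h and P=P, OF N h_meas] by blast
  have R_SUP: "R x = (SUP \<theta>\<in>N. ennreal (h \<theta> x))" if "x \<in> space P" for x
  proof (rule R_eq)
    have "continuous_on N (\<lambda>\<theta>. M \<theta> x)"
      using diff[OF that] by (intro continuous_at_imp_continuous_on ballI differentiable_imp_continuous_within) auto
    then show "continuous_on N (\<lambda>\<theta>. h \<theta> x)"
      using cont[OF that] C unfolding h_def J_def by (intro continuous_intros) auto
  qed
  have "(\<integral>\<^sup>+x. R x \<partial>P) \<le> (\<integral>\<^sup>+x. (SUP \<theta>\<in>N. ennreal (max (norm (M \<theta> x) ^ 3)
           (op_norm (jacobian (\<lambda>\<theta>. M \<theta> x) (at \<theta>)) ^ 3))) \<partial>P)"
  proof (rule nn_integral_mono)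
    fix x assume "x \<in> space P"
    show "R x \<le> (SUP \<theta>\<in>N. ennreal (max (norm (M \<theta> x) ^ 3) (op_norm (jacobian (\<lambda>\<theta>. M \<theta> x) (at \<theta>)) ^ 3)))"
      unfolding R_SUP[OF \<open>x \<in> space P\<close>]
    proof (rule SUP_mono', rule ennreal_leI)
      fix \<theta>
      have "(norm (J \<theta> x) / C) ^ 3 \<le> op_norm (J \<theta> x) ^ 3"
        using J_le C by (intro power_mono) auto
      then show "h \<theta> x \<le> max (norm (M \<theta> x) ^ 3) (op_norm (jacobian (\<lambda>\<theta>. M \<theta> x) (at \<theta>)) ^ 3)"
        unfolding h_def J_def by (intro max.mono) auto
    qed
  qed
  then have R_fin: "(\<integral>\<^sup>+x. R x \<partial>P) < \<infinity>" using fin by (rule le_less_trans)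
  \<comment> \<open>The cube root and the factor C undo the two operations in h, and C >= 1 lets the
    same G bound M. On the null set where R is infinite, \<open>enn2real\<close> makes G
    vanish.\<close>
  define G where "G x = C * root 3 (enn2real (R x))" for x
  show ?thesis
  proof
    show "G \<in> borel_measurable P" unfolding G_def by measurable
    have "integrable P (\<lambda>x. enn2real (R x))"
    proof (rule integrableI_bounded)
      have "(\<integral>\<^sup>+x. ennreal (norm (enn2real (R x))) \<partial>P) \<le> (\<integral>\<^sup>+x. R x \<partial>P)"
        by (intro nn_integral_mono) (simp add: ennreal_enn2real_if)
      then show "(\<integral>\<^sup>+x. ennreal (norm (enn2real (R x))) \<partial>P) < \<infinity>" using R_fin by (rule le_less_trans)
    qed simp
    then show "integrable P (\<lambda>x. G x ^ 3)"
      unfolding G_def by (simp add: power_mult_distrib real_root_pow_pos2)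
    have "AE x in P. R x \<noteq> \<infinity>"
      using R_fin by (intro nn_integral_PInf_AE) auto
    then show "AE x in P. \<forall>\<theta>\<in>N. norm (M \<theta> x) \<le> G x \<and> norm (jacobian (\<lambda>\<theta>. M \<theta> x) (at \<theta>)) \<le> G x"
      using AE_space
    proof (eventually_elim, intro ballI)
      fix x \<theta> assume x: "R x \<noteq> \<infinity>" "x \<in> space P" and "\<theta> \<in> N"
      have "ennreal (h \<theta> x) \<le> R x" unfolding R_SUP[OF x(2)] using \<open>\<theta> \<in> N\<close> by (rule SUP_upper)
      moreover have "0 \<le> h \<theta> x" unfolding h_def by (simp add: le_max_iff_disj)
      ultimately have h_le: "h \<theta> x \<le> enn2real (R x)"
        using x(1) enn2real_mono[of "ennreal (h \<theta> x)" "R x"] by (simp add: less_top)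
      have cube: "a \<le> root 3 (enn2real (R x))" if "0 \<le> a" "a ^ 3 \<le> h \<theta> x" for a
      proof -
        have "root 3 (a ^ 3) \<le> root 3 (enn2real (R x))"
          using that(2) h_le by (intro real_root_le_mono) auto
        then show ?thesis using that(1) by (simp add: real_root_power_cancel)
      qed
      have 1: "norm (M \<theta> x) \<le> root 3 (enn2real (R x))" by (rule cube) (simp_all add: h_def)
      also have "\<dots> \<le> G x"
        unfolding G_def using C mult_right_mono[of 1 C "root 3 (enn2real (R x))"] by simp
      finally have "norm (M \<theta> x) \<le> G x" .
      moreover have "norm (J \<theta> x) / C \<le> root 3 (enn2real (R x))"
        using C by (intro cube) (simp_all add: h_def)
      then have "norm (J \<theta> x) \<le> G x"
        using C unfolding G_def by (simp add: pos_divide_le_eq mult.commute)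
      ultimately show "norm (M \<theta> x) \<le> G x \<and> norm (jacobian (\<lambda>\<theta>. M \<theta> x) (at \<theta>)) \<le> G x"
        unfolding J_def by blast
    qed
  qed
qed

lemma jacobian_eqI:
  fixes f :: "real^'n \<Rightarrow> real^'m"
  assumes "(f has_derivative (\<lambda>v. A *v v)) (at x)"
  shows "jacobian f (at x) = A"
  unfolding jacobian_def frechet_derivative_at[OF assms, symmetric] by simp

text \<open>The estimated inverse Hessian and mean Jacobian depend on the whole sample, so the
  summands are not fixed functions of one observation. As coordinates of the parameter they become
  arguments of the fixed families \<open>If\<close> and \<open>Mf\<close>, whose values are
  \<open>IF\<close> and \<open>Mtilde\<close> at a and the estimated versions at
  \<open>X n \<omega>\<close>.\<close>

lemma (in iid) conv_prob_plug_in: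
  fixes M :: "real^'d \<Rightarrow> 'x \<Rightarrow> real^'m" and dl :: "real^'d \<Rightarrow> 'x \<Rightarrow> real^'d"
    and \<theta>h :: "nat \<Rightarrow> 'w \<Rightarrow> real^'d" and Ih :: "nat \<Rightarrow> 'w \<Rightarrow> real^'d^'d"
  assumes \<theta>h: "conv_prob S \<theta>h \<theta>s"
    and Ih: "conv_prob S Ih (hessian (risk P l) \<theta>s)" "invertible (hessian (risk P l) \<theta>s)"
    and dl: "loc_dominated P 2 \<theta>s dl" and M: "loc_dominated P 2 \<theta>s M"
    and J: "loc_dominated P 1 \<theta>s (\<lambda>\<theta> x. jacobian (\<lambda>\<theta>. M \<theta> x) (at \<theta>))"
    and J_mean: "(\<integral>x. jacobian (\<lambda>\<theta>. M \<theta> x) (at \<theta>s) \<partial>P) = jacobian (mu P M) (at \<theta>s)"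
    and cov: "pos_def (covar P (Mtilde P l dl M \<theta>s \<theta>s) (Mtilde P l dl M \<theta>s \<theta>s))"
  shows "conv_prob S (\<lambda>n \<omega>. H_hat dl M \<xi> n \<omega> (Ih n \<omega>) (\<theta>h n \<omega>)) (Hstar P l dl M \<theta>s)"
proof -
  define W where "W = matrix_inv (hessian (risk P l) \<theta>s)"
  define Jm where "Jm = jacobian (mu P M) (at \<theta>s)"
  define Jh where "Jh n \<omega> = emp \<xi> n \<omega> (\<lambda>x'. jacobian (\<lambda>\<theta>. M \<theta> x') (at (\<theta>h n \<omega>)))" for n \<omega>
  define a where "a = (\<theta>s, W, Jm)"
  define X where "X n \<omega> = (\<theta>h n \<omega>, pinv (Ih n \<omega>), Jh n \<omega>)" for n \<omega>
  have "conv_prob S (\<lambda>n \<omega>. pinv (Ih n \<omega>)) W"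
    unfolding W_def matrix_inv_eq_pinv[OF Ih(2)] by (rule conv_prob_isCont[OF Ih(1) isCont_pinv[OF Ih(2)]])
  \<comment> \<open>The weak law yields the mean of the Jacobian at \<open>\<theta>s\<close>;
    \<open>J_mean\<close> rewrites it as the Jacobian of \<open>mu\<close>.\<close>
  moreover have "conv_prob S Jh Jm"
    using uniform_weak_law[OF J \<theta>h] unfolding Jh_def[abs_def] Jm_def J_mean .
  ultimately have X: "conv_prob S X a"
    unfolding X_def[abs_def] a_def by (intro conv_prob_Pair \<theta>h)
  \<comment> \<open>The minus sign sits on the matrix, so that \<open>If\<close> is the product of a
    factor depending on the parameter alone and the family \<open>dl\<close>.\<close>
  define If where "If \<eta> x = (- fst (snd \<eta>)) *v dl (fst \<eta>) x"
    for \<eta> :: "(real^'d) \<times> (real^'d^'d) \<times> (real^'d^'m)" and x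
  define Mf where "Mf \<eta> x = M (fst \<eta>) x + snd (snd \<eta>) *v If \<eta> x" for \<eta> x
  note [simp] = bounded_bilinear.minus_left[OF bounded_bilinear_matrix_vector_mult]
  have If_a: "If a = IF P l dl \<theta>s"
    by (rule ext) (simp add: If_def a_def W_def IF_def)
  have Mf_a: "Mf a = Mtilde P l dl M \<theta>s \<theta>s"
    by (rule ext) (simp add: Mf_def If_a Mtilde_def, simp add: a_def Jm_def)
  have If_X: "If (X n \<omega>) = IF_hat dl (Ih n \<omega>) (\<theta>h n \<omega>)" for n \<omega>
    by (rule ext) (simp add: If_def X_def IF_hat_def)
  have Mf_X: "Mf (X n \<omega>) = M_hat dl M \<xi> n \<omega> (Ih n \<omega>) (\<theta>h n \<omega>) (\<theta>h n \<omega>)" for n \<omega>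
    by (rule ext) (simp add: Mf_def If_X M_hat_def, simp add: X_def Jh_def)
  have fst_a: "isCont fst a" "fst a = \<theta>s" by (simp_all add: a_def continuous_intros)
  have dl': "loc_dominated P 2 a (\<lambda>\<eta>. dl (fst \<eta>))" and M': "loc_dominated P 2 a (\<lambda>\<eta>. M (fst \<eta>))"
    using loc_dominated_compose[OF _ fst_a(1)] dl M fst_a(2) by simp_all
  have If: "loc_dominated P 2 a If"
    unfolding If_def[abs_def]
    by (rule loc_dominated_bilinear_param[OF bounded_bilinear_matrix_vector_mult _ dl']) (intro continuous_intros)
  have Mf: "loc_dominated P 2 a Mf"
    unfolding Mf_def[abs_def]
    by (rule loc_dominated_add[OF M' loc_dominated_bilinear_param[OF bounded_bilinear_matrix_vector_mult _ If]])
      (intro continuous_intros)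
  note IM = loc_dominated_bilinear[OF bounded_bilinear_outer If Mf]
    and MM = loc_dominated_bilinear[OF bounded_bilinear_outer Mf Mf]
  define V where "V = (\<integral>x. outer (Mf a x) (Mf a x) \<partial>P)"
  have V: "invertible V"
    unfolding V_def
  proof (rule invertible_second_moment[OF prob_space_population])
    show "integrable P (Mf a)"
      by (rule loc_dominated_integrable[OF loc_dominated_power_le[OF prob_space_population Mf]]) simp
    show "integrable P (\<lambda>x. outer (Mf a x) (Mf a x))"
      using loc_dominated_integrable[OF MM] .
    show "pos_def (covar P (Mf a) (Mf a))" unfolding Mf_a by (rule cov)
  qed
  have "isCont (\<lambda>p. - (fst p ** pinv (snd p))) (Q, V)" for Q :: "real^'m^'d"
  proof -
    have "isCont (\<lambda>p. pinv (snd p)) (Q, V)"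
      by (rule isCont_o2[OF continuous_snd[OF continuous_ident]]) (simp add: isCont_pinv[OF V])
    then show ?thesis
      by (intro continuous_minus bounded_bilinear.continuous[OF bounded_bilinear_matrix_matrix_mult]
        continuous_fst continuous_ident)
  qed
  from conv_prob_isCont[OF conv_prob_Pair[OF uniform_weak_law[OF IM X] uniform_weak_law[OF MM X, folded V_def]] this]
  show ?thesis
    unfolding H_hat_def Hstar_def V_def by (simp add: If_a Mf_a If_X Mf_X)
qed

theorem proposition2:
  fixes P :: "'x measure" and S :: "'w measure" and \<Theta> :: "(real^'d) set"
    and l :: "real^'d \<Rightarrow> 'x \<Rightarrow> real" and dl :: "real^'d \<Rightarrow> 'x \<Rightarrow> real^'d"
    and M :: "real^'d \<Rightarrow> 'x \<Rightarrow> real^'m"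
    and \<theta>s :: "real^'d"
    and \<xi> :: "nat \<Rightarrow> 'w \<Rightarrow> 'x"
    and \<theta>h :: "nat \<Rightarrow> 'w \<Rightarrow> real^'d" and Ih :: "nat \<Rightarrow> 'w \<Rightarrow> real^'d^'d"
  assumes "prob_space P"
    and "iid_sample S P \<xi>"
    and "optimality_condition P \<Theta> l \<theta>s"
    and "cost_regularity_condition P S \<Theta> l dl \<theta>s \<xi> \<theta>h"
    and "correct_side_information P \<Theta> l dl M \<theta>s"
    and "hessian_estimator P S \<Theta> l \<xi> \<theta>h Ih"
    and "small_op S (\<lambda>n \<omega>. op_norm (Ih n \<omega> - hessian (risk P l) \<theta>s))"
    and "tight_in S \<Theta> \<theta>h"
    and "ae_strictly_differentiable P l \<theta>s"
  shows "small_op S (\<lambda>n \<omega>. op_norm (H_hat dl M \<xi> n \<omega> (Ih n \<omega>) (\<theta>h n \<omega>) - Hstar P l dl M \<theta>s))"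
proof -
  interpret iid P S \<xi> by unfold_locales fact
  have int: "\<And>\<theta>. \<theta> \<in> \<Theta> \<Longrightarrow> integrable P (l \<theta>)" and "\<theta>s \<in> \<Theta>"
    and min: "\<And>\<theta>. \<theta> \<in> \<Theta> \<Longrightarrow> \<theta> \<noteq> \<theta>s \<Longrightarrow> risk P l \<theta>s < risk P l \<theta>"
    and pd: "pos_def (hessian (risk P l) \<theta>s)"
    using assms(3) unfolding optimality_condition_def by auto
  obtain L where L: "L \<in> borel_measurable P" "integrable P (\<lambda>x. L x ^ 3)"
    "AE x in P. \<forall>\<theta>1\<in>\<Theta>. \<forall>\<theta>2\<in>\<Theta>. \<bar>l \<theta>1 x - l \<theta>2 x\<bar> \<le> L x * norm (\<theta>1 - \<theta>2)"
    using assms(4) unfolding cost_regularity_condition_def by blast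
  have dl_meas: "\<forall>\<theta>\<in>\<Theta>. dl \<theta> \<in> borel_measurable P"
    and sub: "AE x in P. \<forall>\<theta>\<in>interior \<Theta>. dl \<theta> x \<in> clarke_subdifferential (\<lambda>\<theta>. l \<theta> x) \<theta>"
    using assms(4) unfolding cost_regularity_condition_def by blast+
  obtain r where r: "small_op S (\<lambda>n \<omega>. real n * r n \<omega>)"
    "\<forall>n\<ge>1. AE \<omega> in S. \<forall>\<theta>\<in>\<Theta>. emp \<xi> n \<omega> (l (\<theta>h n \<omega>)) \<le> emp \<xi> n \<omega> (l \<theta>) + r n \<omega>"
    using assms(4) unfolding cost_regularity_condition_def by blast
  obtain N where N: "open N" "\<theta>s \<in> N" "N \<subseteq> \<Theta>"
    and diff: "\<And>x \<theta>. x \<in> space P \<Longrightarrow> \<theta> \<in> N \<Longrightarrow> (\<lambda>\<theta>. M \<theta> x) differentiable (at \<theta>)"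
    and cont: "\<And>x. x \<in> space P \<Longrightarrow> continuous_on N (\<lambda>\<theta>. jacobian (\<lambda>\<theta>. M \<theta> x) (at \<theta>))"
    and fin: "(\<integral>\<^sup>+x. (SUP \<theta>\<in>N. ennreal (max (norm (M \<theta> x) ^ 3)
           (op_norm (jacobian (\<lambda>\<theta>. M \<theta> x) (at \<theta>)) ^ 3))) \<partial>P) < \<infinity>"
    using assms(5) unfolding correct_side_information_def by blast
  have M_meas: "\<And>\<theta>. \<theta> \<in> N \<Longrightarrow> M \<theta> \<in> borel_measurable P"
    and cov: "pos_def (covar P (Mtilde P l dl M \<theta>s \<theta>s) (Mtilde P l dl M \<theta>s \<theta>s))"
    using assms(5) N(3) unfolding correct_side_information_def by blast+
  have \<theta>h: "conv_prob S \<theta>h \<theta>s"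
  proof (rule conv_prob_near_minimizer[OF int \<open>\<theta>s \<in> \<Theta>\<close> min _ L(3) r(1) _ assms(8)])
    show "integrable P L" using P.integrable_power_le[OF L(1,2), of 1] by simp
    show "AE \<omega> in S. \<forall>\<theta>\<in>\<Theta>. emp \<xi> n \<omega> (l (\<theta>h n \<omega>)) \<le> emp \<xi> n \<omega> (l \<theta>) + r n \<omega>" if "1 \<le> n" for n
      using r(2) that by blast
  qed
  \<comment> \<open>N is an open subset of \<Theta> around \<open>\<theta>s\<close>, which places
    \<open>\<theta>s\<close> in the interior, where \<open>dl\<close> is known to select Clarke
    subgradients.\<close>
  have U: "open (interior \<Theta>)" "\<theta>s \<in> interior \<Theta>" using N by (auto intro: interiorI)
  have dl: "loc_dominated P 2 \<theta>s dl"
  proof (rule loc_dominated_subgradient[OF U _ L(1) _ _ _ sub])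
    show "l \<theta> \<in> borel_measurable P" if "\<theta> \<in> interior \<Theta>" for \<theta>
      using int[of \<theta>] that interior_subset by blast
    show "integrable P (\<lambda>x. L x ^ 2)" by (rule P.integrable_power_le[OF L(1,2)]) simp
    show "AE x in P. \<forall>\<theta>1\<in>interior \<Theta>. \<forall>\<theta>2\<in>interior \<Theta>. \<bar>l \<theta>1 x - l \<theta>2 x\<bar> \<le> L x * norm (\<theta>1 - \<theta>2)"
      using L(3) by eventually_elim (use interior_subset in blast)
    show "dl \<theta>s \<in> borel_measurable P" using dl_meas \<open>\<theta>s \<in> \<Theta>\<close> by blast
    show "AE x in P. strictly_differentiable_at (\<lambda>\<theta>. l \<theta> x) \<theta>s"
      using assms(9) unfolding ae_strictly_differentiable_def .
  qed
  obtain G where G: "G \<in> borel_measurable P" "integrable P (\<lambda>x. G x ^ 3)"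
    "AE x in P. \<forall>\<theta>\<in>N. norm (M \<theta> x) \<le> G x \<and> norm (jacobian (\<lambda>\<theta>. M \<theta> x) (at \<theta>)) \<le> G x"
    using side_information_envelope[OF N(1) M_meas diff cont fin] by blast
  have M_le: "AE x in P. \<forall>\<theta>\<in>N. norm (M \<theta> x) \<le> G x"
    and J_le: "AE x in P. \<forall>\<theta>\<in>N. norm (jacobian (\<lambda>\<theta>. M \<theta> x) (at \<theta>)) \<le> G x"
    using G(3) by (eventually_elim, blast)+
  have M: "loc_dominated P 2 \<theta>s M"
  proof (rule loc_dominated_continuous[OF N(1,2) M_meas _ G(1) _ M_le])
    show "AE x in P. continuous_on N (\<lambda>\<theta>. M \<theta> x)"
      using diff by (intro AE_I2 continuous_at_imp_continuous_on ballI differentiable_imp_continuous_within) auto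
    show "integrable P (\<lambda>x. G x ^ 2)" by (rule P.integrable_power_le[OF G(1,2)]) simp
  qed
  have J: "loc_dominated P 1 \<theta>s (\<lambda>\<theta> x. jacobian (\<lambda>\<theta>. M \<theta> x) (at \<theta>))"
  proof (rule loc_dominated_continuous[OF N(1,2) _ _ G(1) _ J_le])
    show "(\<lambda>x. jacobian (\<lambda>\<theta>. M \<theta> x) (at \<theta>)) \<in> borel_measurable P" if "\<theta> \<in> N" for \<theta>
      by (rule borel_measurable_jacobian[OF N(1) that M_meas diff[OF _ that]])
    show "AE x in P. continuous_on N (\<lambda>\<theta>. jacobian (\<lambda>\<theta>. M \<theta> x) (at \<theta>))"
      using cont by (rule AE_I2)
    show "integrable P (\<lambda>x. G x ^ 1)" by (rule P.integrable_power_le[OF G(1,2)]) simp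
  qed
  have M_int: "integrable P (M \<theta>)" if "\<theta> \<in> N" for \<theta>
  proof (rule Bochner_Integration.integrable_bound)
    show "integrable P G" using P.integrable_power_le[OF G(1,2), of 1] by simp
    show "AE x in P. norm (M \<theta> x) \<le> norm (G x)"
      using M_le by eventually_elim (use that in fastforce)
  qed (rule M_meas[OF that])
  have J_mean: "(\<integral>x. jacobian (\<lambda>\<theta>. M \<theta> x) (at \<theta>s) \<partial>P) = jacobian (mu P M) (at \<theta>s)"
    using jacobian_eqI[OF has_derivative_mu[OF N(1,2) M_int diff J]] by simp
  have "invertible (hessian (risk P l) \<theta>s)"
    using pd unfolding pos_def_def by (intro invertible_if_positive) blast
  \<comment> \<open>The rewriting turns both the hypothesis on the Hessian estimator and the goal
    into \<open>conv_prob\<close> statements.\<close>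
  with assms(7) show ?thesis
    unfolding conv_prob_iff_op_norm[symmetric]
    using \<theta>h dl M J J_mean cov by (intro conv_prob_plug_in)
qed

end
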